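(* Let $t,b,k$ be positive integers with $3\le k\le t$. Let $l^*$ be a sequence of length $k$ with entries in $\{1,\dots,t\}$ that maximizes $c(l)$ over all such sequences, let $v^*$ be the number of distinct treatments occurring in $l^*$, and let $s^*$ be the set of all sequences obtained from $l^*$ by relabelling the treatments (applying a permutation of $\{1,\dots,t\}$ entrywise). Let $d^*$ be a circular design with $b$ blocks of length $k$ whose inner-plot sequences $(d^*(i,1),\dots,d^*(i,k))$ all lie in $s^*$, each sequence of $s^*$ occurring as the inner-plot sequence of the same number of blocks. Then under model $(\mathcal{M}1)$, $d^*$ is universally optimal for the total effects $\phi=\tau+\lambda$ among all circular designs with $t$ treatments and $b$ blocks of length $k$, and $\mathrm{tr}(C_{d^*}[\phi])=bf(v^* )=bc(l^* )$.
   Context: Designs: $t$ treatments, $b$ linear blocks; block $i$ has inner plots $j=1,\dots,k$ and border plots $j=0,k+1$; a design $d$ assigns treatment $d(i,j)$ to each plot and is circular if $d(i,0)=d(i,k)$, $d(i,k+1)=d(i,1)$. Model $(\mathcal{M}1)$: responses $Y_{i,j}$ ($1\le i\le b$, $1\le j\le k$) uncorrelated with common variance, $\mathbb{E}(Y)=B\beta+T_d\tau+L_d\lambda$ where $B$ is the block incidence matrix and $T_d,L_d$ ($bk\times t$) have in row $(i,j)$ a single $1$ in column $d(i,j)$, resp. $d(i,j-1)$. Total effects $\phi=K'\alpha$, $\alpha=(\tau',\lambda')'$, $K=\mathbf{1}_2\otimes I_t$. Information matrix: with $A^+$ the Moore–Penrose inverse, $\mathrm{pr}_{(A)}=A(A'A)^+A'$,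 $\mathrm{pr}^\perp_{(A)}=I-\mathrm{pr}_{(A)}$, $A=(T_d\mid L_d)$, $M=I-K(K'K)^+K'$, $X_1=AK(K'K)^+$, $X_2=(AM\mid B)$, one sets $C_d[\phi]=X_1'\mathrm{pr}^\perp_{(X_2)}X_1$. For a sequence $l=(l_1,\dots,l_k)$ with entries in $\{1,\dots,t\}$, put $l_0=l_k$; let $n_i$ be the number of occurrences of $i$ in $l$ and $m_i$ the number of $j\in\{1,\dots,k\}$ with $l_{j-1}=l_j=i$; define $c(l)=\frac12\big(k-\frac2k\sum_{i=1}^t n_i^2+\sum_{i=1}^t m_i\big)$. Define $f(v)=-1+k-v/2-(2-v/k)\lfloor k/v\rfloor+(v/k)\lfloor k/v\rfloor^2$. Universal optimality (Kiefer): $d^*$ is universally optimal over $\mathcal{D}$ if $\Phi(C_{d^*})\le\Phi(C_d)$ for all $d\in\mathcal{D}$ and every $\Phi$ on nonnegative definite symmetric $t\times t$ matrices, valued in $(-\infty,\infty]$, that is convex, has $\Phi(aC)$ nonincreasing in $a\ge0$, and is invariant under simultaneous permutation of rows and columns. *)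

theory Defs
  imports "Jordan_Normal_Form.Matrix" "HOL-Combinatorics.Permutations" "HOL-Library.Extended_Real"
begin

definition mp_inv :: "real mat \<Rightarrow> real mat" where
  "mp_inv A = (THE X. X \<in> carrier_mat (dim_col A) (dim_row A) \<and>
      A * X * A = A \<and> X * A * X = X \<and>
      transpose_mat (A * X) = A * X \<and> transpose_mat (X * A) = X * A)"

definition proj :: "real mat \<Rightarrow> real mat" where
  "proj A = A * mp_inv (transpose_mat A * A) * transpose_mat A"

definition proj_perp :: "real mat \<Rightarrow> real mat" where
  "proj_perp A = 1\<^sub>m (dim_row A) - proj A"

definition mat_trace :: "real mat \<Rightarrow> real" where
  "mat_trace A = (\<Sum>i<dim_row A. A $$ (i, i))"

definition nnd_sym :: "nat \<Rightarrow> real mat \<Rightarrow> bool" where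
  "nnd_sym n C \<longleftrightarrow> C \<in> carrier_mat n n \<and> transpose_mat C = C \<and>
      (\<forall>x \<in> carrier_vec n. 0 \<le> x \<bullet> (C *\<^sub>v x))"

text \<open>A design is a function d with d i j the treatment on plot j of block i
 (blocks i = 1..b, plots j = 0..k+1, treatments 1..t).\<close>
definition circular_design :: "nat \<Rightarrow> nat \<Rightarrow> nat \<Rightarrow> (nat \<Rightarrow> nat \<Rightarrow> nat) \<Rightarrow> bool" where
  "circular_design t b k d \<longleftrightarrow>
     (\<forall>i \<in> {1..b}. \<forall>j \<in> {0..k+1}. d i j \<in> {1..t}) \<and>
     (\<forall>i \<in> {1..b}. d i 0 = d i k \<and> d i (k + 1) = d i 1)"

text \<open>Row (i,j) (1-based) of the bk-row matrices is row (i-1)*k+(j-1) (0-based);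
 treatment column c (1-based) is column c-1.\<close>
definition T_mat :: "nat \<Rightarrow> nat \<Rightarrow> nat \<Rightarrow> (nat \<Rightarrow> nat \<Rightarrow> nat) \<Rightarrow> real mat" where
  "T_mat t b k d = mat (b * k) t (\<lambda>(r, c). if d (r div k + 1) (r mod k + 1) = c + 1 then 1 else 0)"

definition L_mat :: "nat \<Rightarrow> nat \<Rightarrow> nat \<Rightarrow> (nat \<Rightarrow> nat \<Rightarrow> nat) \<Rightarrow> real mat" where
  "L_mat t b k d = mat (b * k) t (\<lambda>(r, c). if d (r div k + 1) (r mod k) = c + 1 then 1 else 0)"

definition B_mat :: "nat \<Rightarrow> nat \<Rightarrow> real mat" where
  "B_mat b k = mat (b * k) b (\<lambda>(r, c). if r div k = c then 1 else 0)"

definition A_mat :: "nat \<Rightarrow> nat \<Rightarrow> nat \<Rightarrow> (nat \<Rightarrow> nat \<Rightarrow> nat) \<Rightarrow> real mat" where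
  "A_mat t b k d = mat (b * k) (2 * t)
     (\<lambda>(r, c). if c < t then T_mat t b k d $$ (r, c) else L_mat t b k d $$ (r, c - t))"

text \<open>K = 1_2 \<otimes> I_t\<close>
definition K_mat :: "nat \<Rightarrow> real mat" where
  "K_mat t = mat (2 * t) t (\<lambda>(r, c). if r mod t = c then 1 else 0)"

definition M_mat :: "nat \<Rightarrow> real mat" where
  "M_mat t = 1\<^sub>m (2 * t) - K_mat t * mp_inv (transpose_mat (K_mat t) * K_mat t) * transpose_mat (K_mat t)"

definition X1_mat :: "nat \<Rightarrow> nat \<Rightarrow> nat \<Rightarrow> (nat \<Rightarrow> nat \<Rightarrow> nat) \<Rightarrow> real mat" where
  "X1_mat t b k d = A_mat t b k d * K_mat t * mp_inv (transpose_mat (K_mat t) * K_mat t)"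

definition X2_mat :: "nat \<Rightarrow> nat \<Rightarrow> nat \<Rightarrow> (nat \<Rightarrow> nat \<Rightarrow> nat) \<Rightarrow> real mat" where
  "X2_mat t b k d = mat (b * k) (2 * t + b)
     (\<lambda>(r, c). if c < 2 * t then (A_mat t b k d * M_mat t) $$ (r, c) else B_mat b k $$ (r, c - 2 * t))"

definition info_mat :: "nat \<Rightarrow> nat \<Rightarrow> nat \<Rightarrow> (nat \<Rightarrow> nat \<Rightarrow> nat) \<Rightarrow> real mat" where
  "info_mat t b k d = transpose_mat (X1_mat t b k d) * proj_perp (X2_mat t b k d) * X1_mat t b k d"

definition admissible_criterion :: "nat \<Rightarrow> (real mat \<Rightarrow> ereal) \<Rightarrow> bool" where
  "admissible_criterion t \<Phi> \<longleftrightarrow>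
     \<comment> \<open>convex, with values in (-inf, inf]\<close>
     (\<forall>C. nnd_sym t C \<longrightarrow> \<Phi> C \<noteq> -\<infinity>) \<and>
     (\<forall>C1 C2 a. nnd_sym t C1 \<longrightarrow> nnd_sym t C2 \<longrightarrow> 0 < a \<longrightarrow> a < 1 \<longrightarrow>
        \<Phi> (a \<cdot>\<^sub>m C1 + (1 - a) \<cdot>\<^sub>m C2) \<le> ereal a * \<Phi> C1 + ereal (1 - a) * \<Phi> C2) \<and>
     \<comment> \<open>Phi(aC) nonincreasing in a >= 0\<close>
     (\<forall>C a a'. nnd_sym t C \<longrightarrow> 0 \<le> a \<longrightarrow> a \<le> a' \<longrightarrow> \<Phi> (a' \<cdot>\<^sub>m C) \<le> \<Phi> (a \<cdot>\<^sub>m C)) \<and>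
     \<comment> \<open>invariant under simultaneous permutation of rows and columns\<close>
     (\<forall>C \<pi>. nnd_sym t C \<longrightarrow> \<pi> permutes {0..<t} \<longrightarrow>
        \<Phi> (mat t t (\<lambda>(i, j). C $$ (\<pi> i, \<pi> j))) = \<Phi> C)"

definition universally_optimal ::
  "nat \<Rightarrow> nat \<Rightarrow> nat \<Rightarrow> (nat \<Rightarrow> nat \<Rightarrow> nat) \<Rightarrow> (nat \<Rightarrow> nat \<Rightarrow> nat) set \<Rightarrow> bool" where
  "universally_optimal t b k d' D \<longleftrightarrow>
     (\<forall>\<Phi>. admissible_criterion t \<Phi> \<longrightarrow> (\<forall>d \<in> D. \<Phi> (info_mat t b k d') \<le> \<Phi> (info_mat t b k d)))"

text \<open>A sequence l = (l_1,...,l_k) is a list of length k; seq_at l j = l_j for j >= 1 and l_0 = l_k.\<close>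
definition seq_at :: "nat list \<Rightarrow> nat \<Rightarrow> nat" where
  "seq_at l j = (if j = 0 then last l else l ! (j - 1))"

definition seqs :: "nat \<Rightarrow> nat \<Rightarrow> nat list set" where
  "seqs t k = {l. length l = k \<and> set l \<subseteq> {1..t}}"

definition n_occ :: "nat list \<Rightarrow> nat \<Rightarrow> nat" where
  "n_occ l i = card {j \<in> {1..length l}. seq_at l j = i}"

definition m_occ :: "nat list \<Rightarrow> nat \<Rightarrow> nat" where
  "m_occ l i = card {j \<in> {1..length l}. seq_at l (j - 1) = i \<and> seq_at l j = i}"

definition c_val :: "nat \<Rightarrow> nat list \<Rightarrow> real" where
  "c_val t l = (let k = real (length l) in
     (k - (2 / k) * (\<Sum>i = 1..t. real (n_occ l i) ^ 2) + (\<Sum>i = 1..t. real (m_occ l i))) / 2)"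

definition f_val :: "nat \<Rightarrow> nat \<Rightarrow> real" where
  "f_val k v = -1 + real k - real v / 2 - (2 - real v / real k) * real (k div v)
     + (real v / real k) * real (k div v) ^ 2"

definition inner_seq :: "nat \<Rightarrow> (nat \<Rightarrow> nat \<Rightarrow> nat) \<Rightarrow> nat \<Rightarrow> nat list" where
  "inner_seq k d i = map (d i) [1..<k + 1]"

definition relabellings :: "nat \<Rightarrow> nat list \<Rightarrow> nat list set" where
  "relabellings t l = {map \<sigma> l | \<sigma>. \<sigma> permutes {1..t}}"

end

theory Submission
  imports Defs "Jordan_Normal_Form.Gauss_Jordan_Elimination"
begin

text \<open>
  Write $X_1 = (T_d + L_d)/2$; up to signs the columns of $AM$ are those of $(T_d - L_d)/2$. Dropping the
  nuisance columns $T_d - L_d$ can only enlarge the information matrix, so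
  $C_d \le X_1' \mathrm{pr}^\perp_B X_1$, and for circular designs the trace of the right-hand side is
  the sum of $c(l)$ over the blocks. For $d^*$, averaging over all relabellings makes $T' L$ symmetric,
  hence $T - L$ is orthogonal to $T + L$ and to $B$, and equality holds. Moreover $C_{d^*}$ is
  completely symmetric with zero row sums, so Kiefer's argument applies: averaging $C_d$ over all
  permutations gives a multiple $a C_{d^*}$ with $0 \le a \le 1$.

  The value of $c(l^*)$: read cyclically, a sequence with $v \ge 2$ treatments changes at least $v$ times,
  and for fixed $v$ the sum of the $n_i^2$ is least when $n_i \in \{q, q+1\}$, $q = \lfloor k/v \rfloor$.
  Both bounds are attained by consecutive runs, which gives $f(v)$. A single treatment gives $c = 0$,
  while $f(k) > 0$.
\<close>

section \<open>Moore--Penrose inverses and projectors\<close>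

text \<open>\<open>mp_inv\<close> is a definite description, so nothing about the projectors is
  available until existence and uniqueness hold for every real matrix; existence is drawn from
  Gauss-Jordan elimination, not from a spectral decomposition. Why T'L becomes symmetric: over one
  circular block, (T - L)'(T + L) is antisymmetric in the two treatments, since its symmetric part
  telescopes; summing over all relabellings makes it invariant under exchanging the two, so it
  vanishes. A competing design has to be compared with d* only by trace: zero row sums hold for
  every circular design, and a completely symmetric matrix with zero row sums is determined by its
  trace. The bounds 3 <= k <= t make available the sequence of k distinct treatments, whose value is
  at least f(k) = k/2 - 1 > 0. This excludes constant sequences, for which the bound on the number
  of changes fails, and makes the trace of C_{d*} positive, as the quotient a of the two traces
  requires.\<close>

lemma mult_mat_assoc:
  fixes A :: "'a :: semiring_0 mat"
  assumes "dim_col A = dim_row B" "dim_col B = dim_row C"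
  shows "A * B * C = A * (B * C)"
  by (rule assoc_mult_mat[of _ "dim_row A" "dim_col A" _ "dim_col B" _ "dim_col C"]) (use assms in auto)

lemma transpose_mult_mat:
  fixes A :: "'a :: comm_semiring_0 mat"
  assumes "dim_col A = dim_row B"
  shows "transpose_mat (A * B) = transpose_mat B * transpose_mat A"
  by (rule transpose_mult[of _ "dim_row A" "dim_col A" _ "dim_col B"]) (use assms in auto)

lemma diff_mult_mat:
  fixes A :: "'a :: ring mat"
  assumes "dim_row A = dim_row B" "dim_col A = dim_col B" "dim_col B = dim_row C"
  shows "(A - B) * C = A * C - B * C"
  by (rule minus_mult_distrib_mat[of _ "dim_row A" "dim_col A" _ _ "dim_col C"]) (use assms in auto)

lemma mult_diff_mat:
  fixes A :: "'a :: ring mat"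
  assumes "dim_col A = dim_row B" "dim_row B = dim_row C" "dim_col B = dim_col C"
  shows "A * (B - C) = A * B - A * C"
  by (rule mult_minus_distrib_mat[of _ "dim_row A" "dim_col A" _ "dim_col B"]) (use assms in auto)

lemma mult_smult_mat:
  fixes A :: "'a :: comm_semiring_0 mat"
  assumes "dim_col A = dim_row B"
  shows "A * (c \<cdot>\<^sub>m B) = c \<cdot>\<^sub>m (A * B)"
  by (rule mult_smult_distrib[of _ "dim_row A" "dim_col A" _ "dim_col B"]) (use assms in auto)

lemma smult_mult_mat:
  fixes A :: "'a :: comm_semiring_0 mat"
  assumes "dim_col A = dim_row B"
  shows "(c \<cdot>\<^sub>m A) * B = c \<cdot>\<^sub>m (A * B)"
  by (rule mult_smult_assoc_mat[of _ "dim_row A" "dim_col A" _ "dim_col B"]) (use assms in auto)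

lemma transpose_diff_mat:
  assumes "dim_row A = dim_row B" "dim_col A = dim_col B"
  shows "transpose_mat (A - B :: 'a :: ring mat) = transpose_mat A - transpose_mat B"
  using assms by (intro eq_matI) auto

lemma index_mult_mat_sum:
  assumes "i < dim_row A" "j < dim_col B" "dim_col A = dim_row B"
  shows "(A * B) $$ (i, j) = (\<Sum>l<dim_row B. A $$ (i, l) * B $$ (l, j))"
  using assms by (auto simp: scalar_prod_def atLeast0LessThan intro!: sum.cong)

lemma index_gram_mat_sum:
  assumes "i < dim_col A" "j < dim_col B" "dim_row A = dim_row B"
  shows "(transpose_mat A * B) $$ (i, j) = (\<Sum>l<dim_row B. A $$ (l, i) * B $$ (l, j))"
  using assms by (subst index_mult_mat_sum) auto

section \<open>Gram matrices and generalized inverses\<close>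

lemma gram_eq_zero_imp_zero:
  fixes A :: "real mat"
  assumes A: "A \<in> carrier_mat n m" and z: "transpose_mat A * A = 0\<^sub>m m m"
  shows "A = 0\<^sub>m n m"
proof (rule eq_matI)
  fix i j assume ij: "i < dim_row (0\<^sub>m n m :: real mat)" "j < dim_col (0\<^sub>m n m :: real mat)"
  have "(\<Sum>l<n. A $$ (l, j) * A $$ (l, j)) = (transpose_mat A * A) $$ (j, j)"
    using A ij by (subst index_gram_mat_sum) auto
  also have "\<dots> = 0" using ij z by simp
  finally have "\<forall>l\<in>{..<n}. A $$ (l, j) * A $$ (l, j) = 0"
    by (subst (asm) sum_nonneg_eq_0_iff) auto
  thus "A $$ (i, j) = 0\<^sub>m n m $$ (i, j)" using ij by auto
qed (use A in auto)

text \<open>Over the reals A'A and A have the same kernel: for W = A(Y - Z), the product W'W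
  contains the factor A'A(Y - Z) = 0. This carries identities about A'A down to A.\<close>

lemma gram_mult_cancel:
  fixes A :: "real mat"
  assumes A: "A \<in> carrier_mat n m" and Y: "Y \<in> carrier_mat m p" and Z: "Z \<in> carrier_mat m p"
    and eq: "transpose_mat A * A * Y = transpose_mat A * A * Z"
  shows "A * Y = A * Z"
proof -
  let ?W = "A * (Y - Z)"
  have "transpose_mat A * A * (Y - Z) = 0\<^sub>m m p"
    using A Y Z eq by (simp add: mult_diff_mat)
  hence "transpose_mat ?W * ?W = 0\<^sub>m p p"
    using A Y Z by (simp add: transpose_mult_mat mult_mat_assoc)
  hence "?W = 0\<^sub>m n p" by (rule gram_eq_zero_imp_zero[rotated]) (use A Y Z in auto)
  hence z: "A * Y - A * Z = 0\<^sub>m n p" using A Y Z by (simp add: mult_diff_mat)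
  show ?thesis
  proof (rule eq_matI)
    fix i j assume "i < dim_row (A * Z)" "j < dim_col (A * Z)"
    hence ij: "i < n" "j < p" using A Z by auto
    have "(A * Y - A * Z) $$ (i, j) = 0" using ij by (simp add: z)
    thus "(A * Y) $$ (i, j) = (A * Z) $$ (i, j)" using ij A Y Z by simp
  qed (use A Y Z in auto)
qed

text \<open>The pivot columns of the reduced row echelon form are unit vectors, so the 0/1 matrix
  selecting them is a generalized inverse of the echelon form.\<close>
lemma generalized_inverse_exists:
  fixes A :: "'a :: field mat"
  assumes A: "A \<in> carrier_mat nr nc"
  obtains X where "X \<in> carrier_mat nc nr" "A * X * A = A"
proof -
  define C where "C = gauss_jordan_single A"
  note gj = gauss_jordan_single[OF A C_def[symmetric]]
  from gj(4) obtain P Q where PQ: "C = P * A" "P \<in> carrier_mat nr nr" "Q \<in> carrier_mat nr nr"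
    "Q * P = 1\<^sub>m nr" by blast
  have C: "C \<in> carrier_mat nr nc" by (rule gj(2))
  obtain f where f: "pivot_fun C f nc" using gj(3) C unfolding row_echelon_form_def by auto
  note piv = pivot_funD[OF _ f, of nr]
  define E :: "'a mat" where "E = mat nc nr (\<lambda>(j, i). if f i = j then 1 else 0)"
  have E: "E \<in> carrier_mat nc nr" unfolding E_def by simp
  \<comment> \<open>The value \<open>f i = nc\<close> is the convention for a zero row. Hence C E is
    the diagonal 0/1 matrix marking the nonzero rows, and multiplying C by it from the left changes
    nothing.\<close>
  have CE: "(C * E) $$ (i, l) = (if f l < nc \<and> i = l then 1 else 0)" if "i < nr" "l < nr" for i l
  proof -
    have "(C * E) $$ (i, l) = (\<Sum>j<nc. C $$ (i, j) * (if f l = j then 1 else 0))"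
      using that C E by (subst index_mult_mat_sum) (auto simp: E_def)
    also have "\<dots> = (if f l < nc then C $$ (i, f l) else 0)"
      by (subst sum.cong[OF refl, where h = "\<lambda>j. if j = f l then C $$ (i, f l) else 0"]) auto
    also have "\<dots> = (if f l < nc \<and> i = l then 1 else 0)"
      using piv(4)[of l] piv(5)[of l i] that C by auto
    finally show ?thesis .
  qed
  have "C * E * C = C"
  proof (rule eq_matI)
    fix i j assume "i < dim_row C" "j < dim_col C"
    hence ij: "i < nr" "j < nc" using C by auto
    have "(C * E * C) $$ (i, j) = (\<Sum>l<nr. (if f l < nc \<and> i = l then 1 else 0) * C $$ (l, j))"
      using ij C E by (subst index_mult_mat_sum) (auto simp: CE simp del: index_mult_mat(1) intro!: sum.cong)
    also have "\<dots> = (if f i < nc then C $$ (i, j) else 0)"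
      using ij
      by (subst sum.cong[OF refl, where h = "\<lambda>l. if l = i then (if f i < nc then C $$ (i, j) else 0) else 0"]) auto
    also have "\<dots> = C $$ (i, j)"
      using piv(1)[of i] piv(2)[of i j] ij C by auto
    finally show "(C * E * C) $$ (i, j) = C $$ (i, j)" .
  qed (use C E in auto)
  hence *: "Q * (C * E * C) = Q * C" by simp
  \<comment> \<open>The row operations are invertible, so the generalized inverse E of C = P A pulls
    back to E P for A = Q C.\<close>
  have QC: "Q * C = A" using PQ A by (simp flip: mult_mat_assoc)
  have "A * (E * P) * A = (Q * C) * (E * P) * A" by (simp add: QC)
  also have "\<dots> = Q * (C * E * C)" using PQ A C E by (simp add: mult_mat_assoc)
  also have "\<dots> = A" using * QC by simp
  finally have "A * (E * P) * A = A" .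
  thus ?thesis using that[of "E * P"] PQ E by simp
qed

text \<open>A'A is symmetric, so H' is a generalized inverse together with H. For P = A H A'
  cancellation of A'A yields P A = A and P'A = A; hence P'P = P, and P'P is symmetric.\<close>

lemma gram_generalized_inverse:
  fixes A :: "real mat"
  assumes A: "A \<in> carrier_mat n m" and H: "H \<in> carrier_mat m m"
    and g: "transpose_mat A * A * H * (transpose_mat A * A) = transpose_mat A * A"
  shows "A * H * transpose_mat A * A = A"
    and "transpose_mat (A * H * transpose_mat A) = A * H * transpose_mat A"
proof -
  have "A * (H * (transpose_mat A * A)) = A * 1\<^sub>m m"
    by (rule gram_mult_cancel[OF A]) (use A H g in \<open>auto simp: mult_mat_assoc\<close>)
  thus 1: "A * H * transpose_mat A * A = A" using A H by (simp add: mult_mat_assoc)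
  let ?P = "A * H * transpose_mat A"
  have "transpose_mat (transpose_mat A * A * H * (transpose_mat A * A)) = transpose_mat A * A"
    unfolding g using A by (simp add: transpose_mult_mat)
  hence g': "transpose_mat A * A * transpose_mat H * (transpose_mat A * A) = transpose_mat A * A"
    using A H by (simp add: transpose_mult_mat mult_mat_assoc)
  have "A * (transpose_mat H * (transpose_mat A * A)) = A * 1\<^sub>m m"
    by (rule gram_mult_cancel[OF A]) (use A H g' in \<open>auto simp: mult_mat_assoc\<close>)
  hence 2: "transpose_mat ?P * A = A" using A H by (simp add: mult_mat_assoc transpose_mult_mat)
  have "transpose_mat ?P * ?P = (transpose_mat ?P * A) * H * transpose_mat A"
    using A H by (simp add: mult_mat_assoc transpose_mult_mat)
  hence "transpose_mat ?P * ?P = ?P" using 2 by simp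
  moreover have "transpose_mat (transpose_mat ?P * ?P) = transpose_mat ?P * ?P"
    using A H by (simp add: mult_mat_assoc transpose_mult_mat)
  ultimately show "transpose_mat ?P = ?P" by simp
qed

section \<open>Existence and uniqueness of the Moore-Penrose inverse\<close>

definition is_mp_inv :: "real mat \<Rightarrow> real mat \<Rightarrow> bool" where
  "is_mp_inv A X \<longleftrightarrow> X \<in> carrier_mat (dim_col A) (dim_row A) \<and>
      A * X * A = A \<and> X * A * X = X \<and>
      transpose_mat (A * X) = A * X \<and> transpose_mat (X * A) = X * A"

text \<open>Penrose's argument: A X and A Y are symmetric and each fixes A from the left, so
  transposing A X = (A Y)(A X) identifies them; likewise X A = Y A. Then X = X A X = Y A X = Y A Y =
  Y.\<close>

lemma is_mp_inv_unique:
  assumes X: "is_mp_inv A X" and Y: "is_mp_inv A Y"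
  shows "X = Y"
proof -
  have c: "dim_row X = dim_col A" "dim_col X = dim_row A" "dim_row Y = dim_col A" "dim_col Y = dim_row A"
    using X Y unfolding is_mp_inv_def by auto
  have AX: "A * X = A * Y"
  proof -
    have "A * X = A * Y * (A * X)" using Y c unfolding is_mp_inv_def by (metis mult_mat_assoc index_mult_mat(2,3))
    also have "\<dots> = transpose_mat (A * Y) * transpose_mat (A * X)" using X Y unfolding is_mp_inv_def by simp
    also have "\<dots> = transpose_mat (A * X * (A * Y))" using c by (simp add: transpose_mult_mat)
    also have "A * X * (A * Y) = A * X * A * Y" using c by (simp add: mult_mat_assoc)
    also have "\<dots> = A * Y" using X unfolding is_mp_inv_def by simp
    also have "transpose_mat \<dots> = A * Y" using Y unfolding is_mp_inv_def by simp
    finally show ?thesis .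
  qed
  have XA: "X * A = Y * A"
  proof -
    have "X * A = X * A * (Y * A)" using Y c unfolding is_mp_inv_def by (metis mult_mat_assoc index_mult_mat(2,3))
    also have "\<dots> = transpose_mat (X * A) * transpose_mat (Y * A)" using X Y unfolding is_mp_inv_def by simp
    also have "\<dots> = transpose_mat (Y * A * (X * A))" using c by (simp add: transpose_mult_mat)
    also have "Y * A * (X * A) = Y * (A * X * A)" using c by (simp add: mult_mat_assoc)
    also have "\<dots> = Y * A" using X unfolding is_mp_inv_def by simp
    also have "transpose_mat \<dots> = Y * A" using Y unfolding is_mp_inv_def by simp
    finally show ?thesis .
  qed
  have "X = X * A * X" using X unfolding is_mp_inv_def by simp
  also have "\<dots> = Y * A * X" by (simp add: XA)
  also have "\<dots> = Y * (A * X)" using c by (simp add: mult_mat_assoc)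
  also have "\<dots> = Y * A * Y" using c by (simp add: AX mult_mat_assoc)
  also have "\<dots> = Y" using Y unfolding is_mp_inv_def by simp
  finally show ?thesis .
qed

text \<open>For arbitrary generalized inverses $H_1$ of $A'A$ and $H_2$ of $AA'$,
  the matrix $A' H_2 A H_1 A'$ is the Moore--Penrose inverse of $A$.\<close>
lemma is_mp_inv_exists:
  obtains X where "is_mp_inv A X"
proof -
  define n m where "n = dim_row A" and "m = dim_col A"
  have A: "A \<in> carrier_mat n m" unfolding n_def m_def by auto
  let ?T = "transpose_mat A"
  have T: "?T \<in> carrier_mat m n" using A by simp
  obtain H1 where H1: "H1 \<in> carrier_mat m m" "?T * A * H1 * (?T * A) = ?T * A"
    by (rule generalized_inverse_exists[of "?T * A" m m]) (use A in auto)
  obtain H2 where H2: "H2 \<in> carrier_mat n n" "A * ?T * H2 * (A * ?T) = A * ?T"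
    by (rule generalized_inverse_exists[of "A * ?T" n n]) (use A in auto)
  note P = gram_generalized_inverse[OF A H1]
  note R = gram_generalized_inverse[OF T H2(1), simplified, OF H2(2)]
  let ?X = "?T * H2 * A * H1 * ?T"
  have d: "dim_row H1 = m" "dim_col H1 = m" "dim_row H2 = n" "dim_col H2 = n"
    "dim_row A = n" "dim_col A = m" using A H1 H2 by auto
  \<comment> \<open>A symmetric matrix fixing A' from the left fixes A from the right, by
    transposition.\<close>
  have R1: "A * (?T * H2 * A) = A"
  proof -
    have "A * (?T * H2 * A) = transpose_mat (transpose_mat (?T * H2 * A) * ?T)"
      using d by (simp add: transpose_mult_mat)
    also have "transpose_mat (?T * H2 * A) = ?T * H2 * A" by (rule R(2))
    also have "?T * H2 * A * ?T = ?T" by (rule R(1))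
    finally show ?thesis by simp
  qed
  have AX: "A * ?X = A * H1 * ?T"
  proof -
    have "A * ?X = A * (?T * H2 * A) * H1 * ?T" using d by (simp add: mult_mat_assoc)
    thus ?thesis by (simp add: R1)
  qed
  have XA: "?X * A = ?T * H2 * A"
  proof -
    have "?X * A = ?T * H2 * (A * H1 * ?T * A)" using d by (simp add: mult_mat_assoc)
    thus ?thesis by (simp add: P(1))
  qed
  have "?X * A * ?X = ?T * H2 * (A * ?X)" unfolding XA using d by (simp add: mult_mat_assoc)
  also have "\<dots> = ?X" unfolding AX using d by (simp add: mult_mat_assoc)
  finally have "?X * A * ?X = ?X" .
  moreover have "A * ?X * A = A" unfolding AX by (rule P(1))
  moreover have "?X \<in> carrier_mat (dim_col A) (dim_row A)" using d by auto
  ultimately have "is_mp_inv A ?X"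
    unfolding is_mp_inv_def by (simp only: AX XA P(2) R(2))
  thus ?thesis by (rule that)
qed

lemma mp_inv_eqI: "is_mp_inv A X \<Longrightarrow> mp_inv A = X"
  unfolding mp_inv_def is_mp_inv_def[symmetric] by (blast intro: the_equality is_mp_inv_unique)

lemma is_mp_inv_mp_inv: "is_mp_inv A (mp_inv A)"
  by (metis is_mp_inv_exists mp_inv_eqI)

section \<open>Orthogonal projectors onto column spaces\<close>

context
  fixes X :: "real mat" and n m :: nat
  assumes X: "X \<in> carrier_mat n m"
begin

lemma proj_carrier: "proj X \<in> carrier_mat n n"
  and proj_mult_self: "proj X * X = X"
  and transpose_proj: "transpose_mat (proj X) = proj X"
  and proj_idem: "proj X * proj X = proj X"
proof -
  let ?H = "mp_inv (transpose_mat X * X)"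
  have H: "?H \<in> carrier_mat m m"
    "transpose_mat X * X * ?H * (transpose_mat X * X) = transpose_mat X * X"
    using is_mp_inv_mp_inv[of "transpose_mat X * X"] X unfolding is_mp_inv_def by auto
  show "proj X \<in> carrier_mat n n" using X H(1) unfolding proj_def by auto
  show "proj X * X = X" and "transpose_mat (proj X) = proj X"
    using gram_generalized_inverse[OF X H] unfolding proj_def by auto
  moreover have "proj X * proj X = (proj X * X) * ?H * transpose_mat X"
    using X H(1) unfolding proj_def by (simp add: mult_mat_assoc)
  ultimately show "proj X * proj X = proj X" unfolding proj_def by simp
qed

lemma proj_mult_eq_zero:
  assumes "Z \<in> carrier_mat n p" "transpose_mat X * Z = 0\<^sub>m m p"
  shows "proj X * Z = 0\<^sub>m n p"
proof -
  have H: "mp_inv (transpose_mat X * X) \<in> carrier_mat m m"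
    using is_mp_inv_mp_inv[of "transpose_mat X * X"] X unfolding is_mp_inv_def by auto
  have "proj X * Z = X * mp_inv (transpose_mat X * X) * (transpose_mat X * Z)"
    using X assms(1) H unfolding proj_def by (simp add: mult_mat_assoc)
  thus ?thesis using X H by (simp add: assms(2))
qed

lemma proj_perp_carrier: "proj_perp X \<in> carrier_mat n n"
  and proj_perp_mult_self: "proj_perp X * X = 0\<^sub>m n m"
  and transpose_proj_perp: "transpose_mat (proj_perp X) = proj_perp X"
  and proj_perp_idem: "proj_perp X * proj_perp X = proj_perp X"
  using X proj_carrier proj_mult_self transpose_proj proj_idem unfolding proj_perp_def
  by (auto simp: diff_mult_mat mult_diff_mat transpose_diff_mat)

end

section \<open>Sequences maximizing $c$\<close>

lemma in_set_iff_seq_at: "x \<in> set l \<longleftrightarrow> (\<exists>j\<in>{1..length l}. seq_at l j = x)"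
proof
  assume "x \<in> set l"
  then obtain i where "i < length l" "l ! i = x" by (auto simp: in_set_conv_nth)
  thus "\<exists>j\<in>{1..length l}. seq_at l j = x" by (intro bexI[of _ "Suc i"]) (auto simp: seq_at_def)
qed (auto simp: seq_at_def)

lemma seq_at_in_set: "1 \<le> j \<Longrightarrow> j \<le> length l \<Longrightarrow> seq_at l j \<in> set l"
  using in_set_iff_seq_at by auto

lemma sum_n_occ:
  assumes "finite S" "set l \<subseteq> S"
  shows "(\<Sum>i\<in>S. n_occ l i) = length l"
proof -
  have "(\<Sum>i\<in>S. n_occ l i) = card (\<Union>i\<in>S. {j \<in> {1..length l}. seq_at l j = i})"
    unfolding n_occ_def by (rule card_UN_disjoint[symmetric]) (use assms in auto)
  also have "(\<Union>i\<in>S. {j \<in> {1..length l}. seq_at l j = i}) = {1..length l}"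
    using assms(2) subsetD[OF assms(2) seq_at_in_set] by auto
  finally show ?thesis by simp
qed

lemma sum_m_occ:
  assumes "finite S" "set l \<subseteq> S"
  shows "(\<Sum>i\<in>S. m_occ l i) = card {j \<in> {1..length l}. seq_at l (j - 1) = seq_at l j}"
proof -
  have "(\<Sum>i\<in>S. m_occ l i)
      = card (\<Union>i\<in>S. {j \<in> {1..length l}. seq_at l (j - 1) = i \<and> seq_at l j = i})"
    unfolding m_occ_def by (rule card_UN_disjoint[symmetric]) (use assms in auto)
  also have "(\<Union>i\<in>S. {j \<in> {1..length l}. seq_at l (j - 1) = i \<and> seq_at l j = i})
      = {j \<in> {1..length l}. seq_at l (j - 1) = seq_at l j}"
    using assms(2) subsetD[OF assms(2) seq_at_in_set] by auto
  finally show ?thesis .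
qed

lemma card_changes:
  "card {j \<in> {1..length l}. seq_at l (j - 1) = seq_at l j}
     + card {j \<in> {1..length l}. seq_at l (j - 1) \<noteq> seq_at l j} = length l"
proof -
  have "card {j \<in> {1..length l}. seq_at l (j - 1) = seq_at l j}
      + card {j \<in> {1..length l}. seq_at l (j - 1) \<noteq> seq_at l j}
      = card ({j \<in> {1..length l}. seq_at l (j - 1) = seq_at l j}
        \<union> {j \<in> {1..length l}. seq_at l (j - 1) \<noteq> seq_at l j})"
    by (rule card_Un_disjoint[symmetric]) auto
  also have "{j \<in> {1..length l}. seq_at l (j - 1) = seq_at l j}
        \<union> {j \<in> {1..length l}. seq_at l (j - 1) \<noteq> seq_at l j} = {1..length l}" by auto
  finally show ?thesis by simp
qed

text \<open>Read cyclically, each of at least two occurring treatments has an occurrence preceded by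
  another treatment.\<close>
lemma card_set_le_changes:
  assumes "2 \<le> card (set l)"
  shows "card (set l) \<le> card {j \<in> {1..length l}. seq_at l (j - 1) \<noteq> seq_at l j}"
proof -
  have "\<exists>j\<in>{1..length l}. seq_at l j = x \<and> seq_at l (j - 1) \<noteq> seq_at l j" if x: "x \<in> set l" for x
  proof (rule ccontr)
    assume "\<not> ?thesis"
    hence step: "seq_at l (j - 1) = x" if "j \<in> {1..length l}" "seq_at l j = x" for j
      using that by auto
    \<comment> \<open>An occurrence of x spreads to all earlier positions, down to 0. Position 0 is
      the last entry again, so a second descent from the end shows that l is constant.\<close>
    have down: "seq_at l i = x" if "i \<le> j" "j \<le> length l" "seq_at l j = x" for i j
      using that by (induction rule: inc_induct) (use step[of "Suc _"] in auto)
    obtain j where "j \<in> {1..length l}" "seq_at l j = x" using x in_set_iff_seq_at[of x l] by auto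
    hence "seq_at l 0 = x" using down[of 0 j] by auto
    moreover have "seq_at l (length l) = seq_at l 0"
      using x by (cases l rule: rev_cases) (auto simp: seq_at_def)
    ultimately have "seq_at l i = x" if "i \<le> length l" for i using down[of i "length l"] that by simp
    hence "set l \<subseteq> {x}" using in_set_iff_seq_at[of _ l] by auto
    hence "card (set l) \<le> card {x}" by (intro card_mono) auto
    thus False using assms by simp
  qed
  hence "set l \<subseteq> seq_at l ` {j \<in> {1..length l}. seq_at l (j - 1) \<noteq> seq_at l j}"
    by blast
  thus ?thesis by (intro surj_card_le) auto
qed

text \<open>$(n - q)(n - q - 1) \ge 0$ for integers $n$, with equality iff $n \in \{q, q + 1\}$.\<close>
lemma consecutive_square_bound:
  fixes n q :: nat
  shows "(2 * real q + 1) * real n - real q * (real q + 1) \<le> real n ^ 2"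
proof -
  have "0 \<le> (int n - int q) * (int n - int q - 1)"
    by (cases "n \<le> q") (auto intro!: mult_nonneg_nonneg mult_nonpos_nonpos)
  hence "0 \<le> real_of_int ((int n - int q) * (int n - int q - 1))" by linarith
  thus ?thesis by (simp add: algebra_simps power2_eq_square)
qed

text \<open>Sum the chord bound over the occurring treatments, whose counts add up to k. The
  parameter q stays free: the floor of k/v gives the sharp bound, while q = k serves for constant
  sequences.\<close>

lemma sum_n_occ_square_ge:
  assumes "l \<in> seqs t k"
  shows "(2 * real q + 1) * real k - real (card (set l)) * (real q * (real q + 1))
    \<le> (\<Sum>i = 1..t. real (n_occ l i) ^ 2)"
proof -
  have "real k = (\<Sum>i\<in>set l. real (n_occ l i))"
    using sum_n_occ[of "set l" l] assms unfolding seqs_def by (simp flip: of_nat_sum)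
  hence "(2 * real q + 1) * real k - real (card (set l)) * (real q * (real q + 1))
      = (\<Sum>i\<in>set l. (2 * real q + 1) * real (n_occ l i) - real q * (real q + 1))"
    by (simp add: sum_subtractf sum_distrib_left)
  also have "\<dots> \<le> (\<Sum>i\<in>set l. real (n_occ l i) ^ 2)"
    by (intro sum_mono consecutive_square_bound)
  also have "\<dots> \<le> (\<Sum>i = 1..t. real (n_occ l i) ^ 2)"
    by (rule sum_mono2) (use assms in \<open>auto simp: seqs_def\<close>)
  finally show ?thesis .
qed

text \<open>Every plot either repeats its predecessor or changes, so the reward for the m_i becomes
  a penalty for the number of cyclic changes, the quantity that can be bounded below.\<close>

lemma c_val_seqs:
  assumes "l \<in> seqs t k"
  shows "c_val t l = (real k - (2 / real k) * (\<Sum>i = 1..t. real (n_occ l i) ^ 2)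
    + (real k - real (card {j \<in> {1..k}. seq_at l (j - 1) \<noteq> seq_at l j}))) / 2"
proof -
  have "(\<Sum>i = 1..t. m_occ l i) + card {j \<in> {1..k}. seq_at l (j - 1) \<noteq> seq_at l j} = k"
    using sum_m_occ[of "{1..t}" l] card_changes[of l] assms unfolding seqs_def by auto
  hence "(\<Sum>i = 1..t. real (m_occ l i)) = real k - real (card {j \<in> {1..k}. seq_at l (j - 1) \<noteq> seq_at l j})"
    by (simp flip: of_nat_sum)
  thus ?thesis using assms unfolding c_val_def seqs_def Let_def by auto
qed

text \<open>Origin of f: it is the value of c when there are exactly v changes and the chord bound
  with q = \<open>k div v\<close> is an equality.\<close>

lemma f_val_eq:
  assumes "0 < k"
  shows "f_val k v = (real k - (2 / real k) * ((2 * real (k div v) + 1) * real k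
      - real v * (real (k div v) * (real (k div v) + 1))) + (real k - real v)) / 2"
  using assms unfolding f_val_def by (simp add: field_simps power2_eq_square)

lemma c_val_le_f_val:
  assumes l: "l \<in> seqs t k" and v: "2 \<le> card (set l)"
  shows "c_val t l \<le> f_val k (card (set l))"
proof -
  have k: "0 < k" using l v by (cases l) (auto simp: seqs_def)
  let ?v = "card (set l)"
  have "(2 / real k) * ((2 * real (k div ?v) + 1) * real k - real ?v * (real (k div ?v) * (real (k div ?v) + 1)))
    \<le> (2 / real k) * (\<Sum>i = 1..t. real (n_occ l i) ^ 2)"
    using sum_n_occ_square_ge[OF l] by (intro mult_left_mono) auto
  moreover have "real ?v \<le> real (card {j \<in> {1..k}. seq_at l (j - 1) \<noteq> seq_at l j})"
    using card_set_le_changes[OF v] l unfolding seqs_def by simp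
  ultimately show ?thesis unfolding c_val_seqs[OF l] f_val_eq[OF k]
    by (intro divide_right_mono add_mono diff_left_mono) auto
qed

text \<open>With a single treatment the sum of squares is at least k^2, so c is at most (k - 2k +
  k)/2 = 0. The case is separate because a constant sequence has no change at all.\<close>

lemma two_treatments_if_c_val_pos:
  assumes l: "l \<in> seqs t k" and c: "0 < c_val t l"
  shows "2 \<le> card (set l)"
proof (rule ccontr)
  assume "\<not> ?thesis"
  hence v: "card (set l) \<le> 1" by simp
  have k: "0 < k"
  proof (rule ccontr)
    assume "\<not> 0 < k"
    thus False using c l unfolding c_val_seqs[OF l] by simp
  qed
  \<comment> \<open>This is the chord bound at q = k with at most one treatment.\<close>
  have "real k ^ 2 \<le> (2 * real k + 1) * real k - real (card (set l)) * (real k * (real k + 1))"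
    using mult_right_mono[of "real (card (set l))" 1 "real k * (real k + 1)"] v
    by (simp add: power2_eq_square algebra_simps)
  also have "\<dots> \<le> (\<Sum>i = 1..t. real (n_occ l i) ^ 2)" by (rule sum_n_occ_square_ge[OF l])
  finally have "(2 / real k) * real k ^ 2 \<le> (2 / real k) * (\<Sum>i = 1..t. real (n_occ l i) ^ 2)"
    by (intro mult_left_mono) auto
  hence "2 * real k \<le> (2 / real k) * (\<Sum>i = 1..t. real (n_occ l i) ^ 2)"
    using k by (simp add: power2_eq_square)
  thus False using c unfolding c_val_seqs[OF l] by simp
qed

section \<open>Attainment by consecutive runs\<close>

definition runs :: "(nat \<Rightarrow> nat) \<Rightarrow> nat \<Rightarrow> nat list" where
  "runs g v = concat (map (\<lambda>i. replicate (g i) i) [1..<Suc v])"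

lemma runs_Suc: "runs g (Suc v) = runs g v @ replicate (g (Suc v)) (Suc v)"
  unfolding runs_def by simp

lemma set_runs: "set (runs g v) \<subseteq> {1..v}"
  by (auto simp: runs_def)

lemma sorted_runs: "sorted (runs g v)"
proof (induction v)
  case (Suc v)
  thus ?case using set_runs[of g v] by (fastforce simp: runs_Suc sorted_append)
qed (simp add: runs_def)

lemma length_runs: "length (runs g v) = (\<Sum>i = 1..v. g i)"
  by (induction v) (simp_all add: runs_Suc, simp add: runs_def)

lemma n_occ_count_list: "n_occ l i = count_list l i"
proof -
  have "n_occ l i = card {j. j < length l \<and> l ! j = i}"
    unfolding n_occ_def by (rule bij_betw_same_card[of "\<lambda>j. j - 1"], rule bij_betwI[where g = Suc])
      (auto simp: seq_at_def)
  also have "\<dots> = count_list l i"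
    by (simp add: count_list_eq_length_filter length_filter_conv_card eq_commute)
  finally show ?thesis .
qed

lemma n_occ_runs: "n_occ (runs g v) i = (if i \<in> {1..v} then g i else 0)"
  unfolding n_occ_count_list
proof (induction v)
  case (Suc v)
  have "count_list (replicate n x) y = (if x = y then n else 0)" for n and x y :: nat
    by (induction n) auto
  thus ?case using Suc by (auto simp: runs_Suc)
qed (simp add: runs_def)

text \<open>An interior change of a sorted list jumps to a strictly larger value; these values are
  distinct and at least 2, which allows v - 1 of them. Position 1, whose predecessor is the last
  entry, adds at most one.\<close>

lemma changes_sorted_le:
  assumes "sorted l" "set l \<subseteq> {1..v}" "0 < v"
  shows "card {j \<in> {1..length l}. seq_at l (j - 1) \<noteq> seq_at l j} \<le> v"
proof -
  let ?J = "{j \<in> {2..length l}. l ! (j - 2) < l ! (j - 1)}"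
  have "{j \<in> {1..length l}. seq_at l (j - 1) \<noteq> seq_at l j} \<subseteq> insert 1 ?J"
  proof
    fix j assume j: "j \<in> {j \<in> {1..length l}. seq_at l (j - 1) \<noteq> seq_at l j}"
    show "j \<in> insert 1 ?J"
    proof (cases "j = 1")
      case False
      hence "j \<ge> 2" using j by auto
      moreover have "l ! (j - 2) \<le> l ! (j - 1)"
        using j \<open>j \<ge> 2\<close> by (intro sorted_nth_mono[OF assms(1)]) auto
      ultimately show ?thesis using j by (auto simp: seq_at_def numeral_2_eq_2)
    qed simp
  qed
  hence "card {j \<in> {1..length l}. seq_at l (j - 1) \<noteq> seq_at l j} \<le> card (insert 1 ?J)"
    by (intro card_mono) auto
  also have "\<dots> \<le> Suc (card ?J)" by (rule card_insert_le_m1) auto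
  also have "card ?J \<le> card {2..v}"
  proof (rule card_inj_on_le[of "\<lambda>j. l ! (j - 1)"])
    have "l ! (i - 1) < l ! (j - 1)" if "i \<in> ?J" "j \<in> ?J" "i < j" for i j
    proof -
      have "l ! (i - 1) \<le> l ! (j - 2)" using that by (intro sorted_nth_mono[OF assms(1)]) auto
      thus ?thesis using that by auto
    qed
    thus "inj_on (\<lambda>j. l ! (j - 1)) ?J" by (intro linorder_inj_onI) (auto simp: less_le)
    show "(\<lambda>j. l ! (j - 1)) ` ?J \<subseteq> {2..v}"
    proof (rule image_subsetI)
      fix j assume j: "j \<in> ?J"
      hence "l ! (j - 2) \<in> {1..v}" "l ! (j - 1) \<in> {1..v}"
        using subsetD[OF assms(2) nth_mem] by auto
      thus "l ! (j - 1) \<in> {2..v}" using j by auto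
    qed
  qed simp
  finally show ?thesis using assms(3) by simp
qed

lemma f_val_attained:
  assumes v: "1 \<le> v" "v \<le> k" "v \<le> t"
  obtains l where "l \<in> seqs t k" "f_val k v \<le> c_val t l"
proof -
  define q r where "q = k div v" and "r = k mod v"
  have qr: "k = v * q + r" "r < v" using v unfolding q_def r_def by auto
  \<comment> \<open>The remainder r is spread over the first r treatments. All counts then lie in
    {q, q + 1}, where the chord bound is an equality.\<close>
  define g where "g i = (if i \<le> r then q + 1 else q)" for i
  define l where "l = runs g v"
  have "(\<Sum>i = 1..v. g i) = (\<Sum>i = 1..v. q) + (\<Sum>i = 1..v. if i \<le> r then 1 else (0::nat))"
    unfolding g_def by (subst sum.distrib[symmetric]) (auto intro: sum.cong)
  also have "(\<Sum>i = 1..v. if i \<le> r then 1 else 0) = card {i \<in> {1..v}. i \<le> r}"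
    by (simp flip: sum.inter_filter)
  also have "{i \<in> {1..v}. i \<le> r} = {1..r}" using qr by auto
  finally have sg: "(\<Sum>i = 1..v. g i) = k" using qr(1) by (simp add: add.commute)
  have l: "l \<in> seqs t k"
    using set_runs[of g v] v sg unfolding seqs_def l_def by (auto simp: length_runs)
  have "(\<Sum>i = 1..t. real (n_occ l i) ^ 2) = (\<Sum>i = 1..v. real (n_occ l i) ^ 2)"
    by (rule sum.mono_neutral_right) (use v in \<open>auto simp: l_def n_occ_runs\<close>)
  also have "\<dots> = (\<Sum>i = 1..v. (2 * real q + 1) * real (g i) - real q * (real q + 1))"
    by (intro sum.cong) (auto simp: l_def n_occ_runs g_def power2_eq_square algebra_simps)
  also have "\<dots> = (2 * real q + 1) * real k - real v * (real q * (real q + 1))"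
    unfolding sum_subtractf sum_distrib_left[symmetric] of_nat_sum[symmetric] sg by simp
  finally have sq: "(\<Sum>i = 1..t. real (n_occ l i) ^ 2) = \<dots>" .
  have "card {j \<in> {1..k}. seq_at l (j - 1) \<noteq> seq_at l j} \<le> v"
    using changes_sorted_le[of l v] sorted_runs[of g v] set_runs[of g v] v l
    unfolding l_def seqs_def by auto
  hence "f_val k v \<le> c_val t l"
    using v unfolding c_val_seqs[OF l] sq by (subst f_val_eq) (auto simp: q_def)
  thus ?thesis using that l by blast
qed

lemma c_val_maximal_pos:
  assumes "3 \<le> k" "k \<le> t" "\<forall>l' \<in> seqs t k. c_val t l' \<le> c_val t l"
  shows "0 < c_val t l"
proof -
  obtain l' where "l' \<in> seqs t k" "f_val k k \<le> c_val t l'"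
    using f_val_attained[of k k t] assms by auto
  moreover have "0 < f_val k k" using assms by (simp add: f_val_def)
  ultimately show ?thesis using assms(3) by fastforce
qed

text \<open>Upper bound and attainment are both used at the number of treatments of l itself, so f
  never has to be maximized over v.\<close>

lemma c_val_maximal_eq_f_val:
  assumes "3 \<le> k" "k \<le> t" and l: "l \<in> seqs t k" and max: "\<forall>l' \<in> seqs t k. c_val t l' \<le> c_val t l"
  shows "c_val t l = f_val k (card (set l))"
proof (rule antisym)
  have v: "2 \<le> card (set l)"
    using two_treatments_if_c_val_pos[OF l] c_val_maximal_pos[OF assms(1,2) max] by simp
  show "c_val t l \<le> f_val k (card (set l))" by (rule c_val_le_f_val[OF l v])
  have "card (set l) \<le> k" using card_length[of l] l by (simp add: seqs_def)
  then obtain l' where "l' \<in> seqs t k" "f_val k (card (set l)) \<le> c_val t l'"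
    using f_val_attained[of "card (set l)" k t] v assms(2) by auto
  thus "f_val k (card (set l)) \<le> c_val t l" using max by fastforce
qed

section \<open>Averaging over permutations\<close>

text \<open>Transpositions identify all diagonal entries, and those fixing i identify the
  off-diagonal entries of row i; the zero row sum links the two values. For n =
  \<open>card S\<close>, the right-hand side is the trace over n - 1 times the centering matrix I -
  J/n, with J the all-ones matrix.\<close>

lemma permutation_invariant_zero_row_sums:
  fixes F :: "'a \<Rightarrow> 'a \<Rightarrow> real"
  assumes fin: "finite S" and S: "2 \<le> card S"
    and inv: "\<And>\<pi> i j. \<pi> permutes S \<Longrightarrow> i \<in> S \<Longrightarrow> j \<in> S \<Longrightarrow> F (\<pi> i) (\<pi> j) = F i j"
    and row: "\<And>i. i \<in> S \<Longrightarrow> (\<Sum>j\<in>S. F i j) = 0"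
    and ij: "i \<in> S" "j \<in> S"
  shows "F i j = (\<Sum>s\<in>S. F s s) * (if i = j then 1 / card S else - 1 / (card S * (real (card S) - 1)))"
proof -
  have diag: "F l l = F i i" if "l \<in> S" for l
    using inv[OF permutes_swap_id[OF ij(1) that] ij(1) ij(1)] by simp
  hence tr: "(\<Sum>s\<in>S. F s s) = card S * F i i" by simp
  have off: "F i l = F i j" if "l \<in> S" "l \<noteq> i" "j \<noteq> i" for l
    using inv[OF permutes_swap_id[OF ij(2) that(1)] ij] that by (simp add: transpose_apply_other)
  show ?thesis
  proof (cases "i = j")
    case True
    thus ?thesis using tr S by simp
  next
    case False
    have "0 = F i i + (\<Sum>l\<in>S - {i}. F i l)" using row[OF ij(1)] ij(1) fin by (simp add: sum.remove)
    also have "(\<Sum>l\<in>S - {i}. F i l) = (\<Sum>l\<in>S - {i}. F i j)" using off False by (intro sum.cong) auto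
    also have "\<dots> = (real (card S) - 1) * F i j" using ij fin S by (simp add: of_nat_diff)
    finally have "F i i = - ((real (card S) - 1) * F i j)" by simp
    hence "(\<Sum>s\<in>S. F s s) = - (card S * (real (card S) - 1)) * F i j" by (simp add: tr)
    moreover have "card S * (real (card S) - 1) \<noteq> 0" using S by simp
    ultimately show ?thesis using False by simp
  qed
qed

section \<open>Nonnegative definite matrices and Kiefer's averaging argument\<close>

lemma quadratic_form_sum:
  assumes "C \<in> carrier_mat n n" "x \<in> carrier_vec n"
  shows "x \<bullet> (C *\<^sub>v x) = (\<Sum>i\<in>{0..<n}. \<Sum>j\<in>{0..<n}. x $ i * C $$ (i, j) * x $ j)"
  using assms by (auto simp: scalar_prod_def sum_distrib_left mult.assoc intro!: sum.cong)

lemma nnd_sym_index_sym: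
  assumes "nnd_sym n C" "i < n" "j < n"
  shows "C $$ (i, j) = C $$ (j, i)"
proof -
  have "C \<in> carrier_mat n n" using assms unfolding nnd_sym_def by simp
  hence "C $$ (i, j) = transpose_mat C $$ (j, i)" using assms(2,3) by simp
  also have "transpose_mat C = C" using assms unfolding nnd_sym_def by simp
  finally show ?thesis .
qed

lemma nnd_symI:
  assumes "C \<in> carrier_mat n n" "\<And>i j. i < n \<Longrightarrow> j < n \<Longrightarrow> C $$ (i, j) = C $$ (j, i)"
    "\<And>x. x \<in> carrier_vec n \<Longrightarrow> 0 \<le> (\<Sum>i\<in>{0..<n}. \<Sum>j\<in>{0..<n}. x $ i * C $$ (i, j) * x $ j)"
  shows "nnd_sym n C"
  unfolding nnd_sym_def using assms by (auto simp: quadratic_form_sum)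

lemma nnd_symD:
  assumes "nnd_sym n C" "x \<in> carrier_vec n"
  shows "0 \<le> (\<Sum>i\<in>{0..<n}. \<Sum>j\<in>{0..<n}. x $ i * C $$ (i, j) * x $ j)"
  using assms unfolding nnd_sym_def by (auto simp: quadratic_form_sum)

lemma nnd_sym_trace_nonneg:
  assumes "nnd_sym n C"
  shows "0 \<le> mat_trace C"
proof -
  have "0 \<le> C $$ (l, l)" if l: "l < n" for l
  proof -
    have "0 \<le> (\<Sum>i\<in>{0..<n}. \<Sum>j\<in>{0..<n}. unit_vec n l $ i * C $$ (i, j) * unit_vec n l $ j)"
      by (rule nnd_symD[OF assms]) simp
    also have "\<dots> = (\<Sum>i\<in>{0..<n}. \<Sum>j\<in>{0..<n}. if j = l then (if i = l then C $$ (i, j) else 0) else 0)"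
      using l by (intro sum.cong) auto
    also have "\<dots> = C $$ (l, l)" using l by simp
    finally show ?thesis .
  qed
  thus ?thesis using assms unfolding mat_trace_def nnd_sym_def by (auto intro!: sum_nonneg)
qed

lemma nnd_sym_permute:
  assumes C: "nnd_sym n C" and p: "\<pi> permutes {0..<n}"
  shows "nnd_sym n (mat n n (\<lambda>(i, j). C $$ (\<pi> i, \<pi> j)))"
proof (rule nnd_symI)
  have lt: "\<pi> i < n" if "i < n" for i using permutes_in_image[OF p, of i] that by simp
  show "mat n n (\<lambda>(i, j). C $$ (\<pi> i, \<pi> j)) $$ (i, j) = mat n n (\<lambda>(i, j). C $$ (\<pi> i, \<pi> j)) $$ (j, i)"
    if "i < n" "j < n" for i j using that lt nnd_sym_index_sym[OF C] by simp
  fix x :: "real vec" assume "x \<in> carrier_vec n"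
  \<comment> \<open>Moving the coordinates of x along the permutation turns the form of the permuted
    matrix at x into the form of C at y.\<close>
  define y where "y = vec n (\<lambda>i. x $ (inv_into UNIV \<pi> i))"
  have y: "y $ (\<pi> i) = x $ i" if "i < n" for i
    using that lt permutes_inverses(2)[OF p] unfolding y_def by simp
  have "0 \<le> (\<Sum>i\<in>{0..<n}. \<Sum>j\<in>{0..<n}. y $ i * C $$ (i, j) * y $ j)"
    by (rule nnd_symD[OF C]) (simp add: y_def)
  also have "\<dots> = (\<Sum>i\<in>{0..<n}. \<Sum>j\<in>{0..<n}. y $ (\<pi> i) * C $$ (\<pi> i, \<pi> j) * y $ (\<pi> j))"
    by (subst sum.permute[OF p], simp add: o_def, rule sum.cong[OF refl], subst sum.permute[OF p])
      (simp add: o_def)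
  also have "\<dots> = (\<Sum>i\<in>{0..<n}. \<Sum>j\<in>{0..<n}. x $ i * mat n n (\<lambda>(i, j). C $$ (\<pi> i, \<pi> j)) $$ (i, j) * x $ j)"
    by (intro sum.cong) (auto simp: y)
  finally show "0 \<le> \<dots>" .
qed simp

lemma nnd_sym_convex:
  assumes C: "nnd_sym n C" and D: "nnd_sym n D" and a: "0 \<le> a" "a \<le> 1"
  shows "nnd_sym n (a \<cdot>\<^sub>m C + (1 - a) \<cdot>\<^sub>m D)"
proof (rule nnd_symI)
  have d: "dim_row C = n" "dim_col C = n" "dim_row D = n" "dim_col D = n"
    using C D unfolding nnd_sym_def by auto
  show "a \<cdot>\<^sub>m C + (1 - a) \<cdot>\<^sub>m D \<in> carrier_mat n n" using d by auto
  show "(a \<cdot>\<^sub>m C + (1 - a) \<cdot>\<^sub>m D) $$ (i, j) = (a \<cdot>\<^sub>m C + (1 - a) \<cdot>\<^sub>m D) $$ (j, i)"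
    if "i < n" "j < n" for i j
    using that d nnd_sym_index_sym[OF C that] nnd_sym_index_sym[OF D that] by simp
  fix x :: "real vec" assume x: "x \<in> carrier_vec n"
  have "0 \<le> a * (\<Sum>i\<in>{0..<n}. \<Sum>j\<in>{0..<n}. x $ i * C $$ (i, j) * x $ j)
    + (1 - a) * (\<Sum>i\<in>{0..<n}. \<Sum>j\<in>{0..<n}. x $ i * D $$ (i, j) * x $ j)"
    using nnd_symD[OF C x] nnd_symD[OF D x] a by simp
  also have "\<dots> = (\<Sum>i\<in>{0..<n}. \<Sum>j\<in>{0..<n}. x $ i * (a \<cdot>\<^sub>m C + (1 - a) \<cdot>\<^sub>m D) $$ (i, j) * x $ j)"
    unfolding sum_distrib_left sum.distrib[symmetric] using d by (intro sum.cong) (auto simp: algebra_simps)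
  finally show "0 \<le> \<dots>" .
qed

text \<open>Two-point convexity, iterated. A common bound c in place of the mean of the values keeps
  the extended-real arithmetic simple. Definiteness is carried through the induction because the
  criterion is constrained only on such matrices.\<close>

lemma admissible_criterion_average:
  assumes \<Phi>: "admissible_criterion t \<Phi>"
    and S: "finite S" "S \<noteq> {}"
    and D: "\<And>s. s \<in> S \<Longrightarrow> nnd_sym t (D s) \<and> \<Phi> (D s) \<le> c"
  shows "nnd_sym t (mat t t (\<lambda>(i, j). (\<Sum>s\<in>S. D s $$ (i, j)) / card S))
    \<and> \<Phi> (mat t t (\<lambda>(i, j). (\<Sum>s\<in>S. D s $$ (i, j)) / card S)) \<le> c"
  using S D
proof (induction rule: finite_ne_induct)
  case (singleton s)
  have "mat t t (\<lambda>(i, j). (\<Sum>s\<in>{s}. D s $$ (i, j)) / card {s}) = D s"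
    using singleton unfolding nnd_sym_def by (intro eq_matI) auto
  thus ?case using singleton by simp
next
  case (insert s S)
  let ?avg = "\<lambda>S. mat t t (\<lambda>(i, j). (\<Sum>s\<in>S. D s $$ (i, j)) / card S)"
  define a where "a = 1 / real (card S + 1)"
  have pos: "0 < card S" using insert by (simp add: card_gt_0_iff)
  hence a: "0 < a" "a < 1" unfolding a_def by (auto simp: field_simps)
  have IH: "nnd_sym t (?avg S)" "\<Phi> (?avg S) \<le> c"
    using insert.IH[OF insert.prems] by blast+
  have s: "nnd_sym t (D s)" "\<Phi> (D s) \<le> c" using insert by auto
  have a': "1 - a = real (card S) * a" unfolding a_def by (simp add: field_simps)
  have entry: "a * x + (1 - a) * (y / real (card S)) = (x + y) / (1 + real (card S))" for x y
    unfolding a' using pos by (simp add: a_def add_divide_distrib add.commute)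
  have eq: "?avg (insert s S) = a \<cdot>\<^sub>m D s + (1 - a) \<cdot>\<^sub>m ?avg S"
  proof (rule eq_matI)
    fix i j assume "i < dim_row (a \<cdot>\<^sub>m D s + (1 - a) \<cdot>\<^sub>m ?avg S)"
      "j < dim_col (a \<cdot>\<^sub>m D s + (1 - a) \<cdot>\<^sub>m ?avg S)"
    hence ij: "i < t" "j < t" by auto
    show "?avg (insert s S) $$ (i, j) = (a \<cdot>\<^sub>m D s + (1 - a) \<cdot>\<^sub>m ?avg S) $$ (i, j)"
      using ij s(1) insert.hyps entry[of "D s $$ (i, j)" "\<Sum>s\<in>S. D s $$ (i, j)"]
      unfolding nnd_sym_def by auto
  qed auto
  have "\<Phi> (?avg (insert s S)) \<le> ereal a * \<Phi> (D s) + ereal (1 - a) * \<Phi> (?avg S)"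
    using \<Phi> s IH a unfolding eq admissible_criterion_def by blast
  also have "\<dots> \<le> ereal a * c + ereal (1 - a) * c"
    using s IH a by (intro add_mono ereal_mult_left_mono) auto
  also have "\<dots> = c"
    using a by (cases c) (auto simp: algebra_simps)
  finally have "\<Phi> (?avg (insert s S)) \<le> c" .
  moreover have "nnd_sym t (?avg (insert s S))"
    unfolding eq using nnd_sym_convex[OF s(1) IH(1)] a by simp
  ultimately show ?case by blast
qed

lemma universal_optimality_criterion:
  assumes t: "2 \<le> t" and \<Phi>: "admissible_criterion t \<Phi>"
    and C: "nnd_sym t C" and C0: "\<And>i. i < t \<Longrightarrow> (\<Sum>j\<in>{0..<t}. C $$ (i, j)) = 0"
    and D: "nnd_sym t D" and D0: "\<And>i. i < t \<Longrightarrow> (\<Sum>j\<in>{0..<t}. D $$ (i, j)) = 0"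
    and Dinv: "\<And>\<pi> i j. \<pi> permutes {0..<t} \<Longrightarrow> i < t \<Longrightarrow> j < t \<Longrightarrow> D $$ (\<pi> i, \<pi> j) = D $$ (i, j)"
    and tr: "mat_trace C \<le> mat_trace D" "0 < mat_trace D"
  shows "\<Phi> D \<le> \<Phi> C"
proof -
  define S where "S = {\<pi>. \<pi> permutes {0..<t}}"
  define P where "P \<pi> = mat t t (\<lambda>(i, j). C $$ (\<pi> i, \<pi> j))" for \<pi> :: "nat \<Rightarrow> nat"
  define A where "A = mat t t (\<lambda>(i, j). (\<Sum>\<pi>\<in>S. P \<pi> $$ (i, j)) / card S)"
  have S: "finite S" "S \<noteq> {}" unfolding S_def using permutes_id[of "{0..<t}"]
    by (auto intro!: finite_permutations simp del: permutes_id)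
  have A\<Phi>: "\<Phi> A \<le> \<Phi> C"
    using admissible_criterion_average[OF \<Phi> S, of P "\<Phi> C"] C nnd_sym_permute[OF C] \<Phi>
    unfolding A_def P_def S_def admissible_criterion_def by auto
  have lt: "\<pi> i < t" if "\<pi> permutes {0..<t}" "i < t" for \<pi> i
    using permutes_in_image[OF that(1), of i] that by simp
  define F where "F i j = (\<Sum>\<pi>\<in>S. C $$ (\<pi> i, \<pi> j)) / card S" for i j
  have A_F: "A $$ (i, j) = F i j" if "i < t" "j < t" for i j
    using that unfolding A_def P_def F_def by simp
  have F: "F i j = (\<Sum>s\<in>{0..<t}. F s s) *
      (if i = j then 1 / card {0..<t} else - 1 / (card {0..<t} * (real (card {0..<t}) - 1)))"
    if "i < t" "j < t" for i j
  \<comment> \<open>Right composition with a fixed permutation only reorders the average, so it is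
    invariant; it inherits zero row sums from C because each summand merely rearranges a
    row.\<close>
  proof (rule permutation_invariant_zero_row_sums)
    fix \<rho> i j assume r: "\<rho> permutes {0..<t}"
    have "(\<Sum>\<pi>\<in>S. C $$ (\<pi> i, \<pi> j)) = (\<Sum>\<pi>\<in>S. C $$ ((\<pi> \<circ> \<rho>) i, (\<pi> \<circ> \<rho>) j))"
      unfolding S_def by (rule sum_permutations_compose_right[OF r])
    thus "F (\<rho> i) (\<rho> j) = F i j" unfolding F_def by simp
  next
    fix i assume i: "i \<in> {0..<t}"
    have "(\<Sum>j\<in>{0..<t}. \<Sum>\<pi>\<in>S. C $$ (\<pi> i, \<pi> j)) = (\<Sum>\<pi>\<in>S. \<Sum>j\<in>{0..<t}. C $$ (\<pi> i, \<pi> j))"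
      by (rule sum.swap)
    also have "\<dots> = (\<Sum>\<pi>\<in>S. \<Sum>j\<in>{0..<t}. C $$ (\<pi> i, j))"
      by (intro sum.cong refl sum.permute[symmetric, unfolded o_def]) (auto simp: S_def)
    also have "\<dots> = 0" using i lt C0 by (auto simp: S_def intro!: sum.neutral)
    finally show "(\<Sum>j\<in>{0..<t}. F i j) = 0" unfolding F_def by (simp flip: sum_divide_distrib)
  qed (use t that in auto)
  have G: "D $$ (i, j) = (\<Sum>s\<in>{0..<t}. D $$ (s, s)) *
      (if i = j then 1 / card {0..<t} else - 1 / (card {0..<t} * (real (card {0..<t}) - 1)))"
    if "i < t" "j < t" for i j
    by (rule permutation_invariant_zero_row_sums[of _ "\<lambda>i j. D $$ (i, j)"]) (use t that Dinv D0 in auto)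
  have "(\<Sum>s\<in>{0..<t}. \<Sum>\<pi>\<in>S. C $$ (\<pi> s, \<pi> s)) = (\<Sum>\<pi>\<in>S. \<Sum>s\<in>{0..<t}. C $$ (\<pi> s, \<pi> s))"
    by (rule sum.swap)
  also have "\<dots> = (\<Sum>\<pi>\<in>S. \<Sum>s\<in>{0..<t}. C $$ (s, s))"
    by (intro sum.cong refl sum.permute[symmetric, unfolded o_def]) (auto simp: S_def)
  finally have "(\<Sum>s\<in>{0..<t}. F s s) = (\<Sum>s\<in>{0..<t}. C $$ (s, s))"
    using S unfolding F_def by (simp flip: sum_divide_distrib)
  moreover have dims: "C \<in> carrier_mat t t" "D \<in> carrier_mat t t" using C D unfolding nnd_sym_def by auto
  ultimately have trs: "(\<Sum>s\<in>{0..<t}. F s s) = mat_trace C" "(\<Sum>s\<in>{0..<t}. D $$ (s, s)) = mat_trace D"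
    unfolding mat_trace_def by (auto simp: atLeast0LessThan)
  \<comment> \<open>The average and D have the same shape, so the ratio of their traces is the
    scalar between them. Since a is at most 1, monotonicity along multiples of D finishes the
    comparison.\<close>
  define a where "a = mat_trace C / mat_trace D"
  have a: "0 \<le> a" "a \<le> 1" using tr nnd_sym_trace_nonneg[OF C] unfolding a_def by auto
  have "A = a \<cdot>\<^sub>m D"
  proof (rule eq_matI)
    fix i j assume "i < dim_row (a \<cdot>\<^sub>m D)" "j < dim_col (a \<cdot>\<^sub>m D)"
    hence ij: "i < t" "j < t" using dims by auto
    have "A $$ (i, j) = a * D $$ (i, j)"
      unfolding A_F[OF ij] F[OF ij] G[OF ij] trs a_def using tr(2) by simp
    thus "A $$ (i, j) = (a \<cdot>\<^sub>m D) $$ (i, j)" using ij dims by simp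
  qed (use dims in \<open>auto simp: A_def\<close>)
  moreover have "\<Phi> (1 \<cdot>\<^sub>m D) \<le> \<Phi> (a \<cdot>\<^sub>m D)"
    using \<Phi> D a unfolding admissible_criterion_def by blast
  moreover have "1 \<cdot>\<^sub>m D = D" by (intro eq_matI) auto
  ultimately show ?thesis using A\<Phi> by simp
qed

section \<open>The information matrix\<close>

lemma gram_nnd_sym:
  assumes W: "W \<in> carrier_mat n t"
  shows "nnd_sym t (transpose_mat W * W)"
proof (rule nnd_symI)
  show "(transpose_mat W * W) $$ (i, j) = (transpose_mat W * W) $$ (j, i)" if "i < t" "j < t" for i j
    using W that by (simp add: index_gram_mat_sum mult.commute del: index_mult_mat(1))
  fix x :: "real vec" assume x: "x \<in> carrier_vec t"
  have "0 \<le> (\<Sum>l<n. (\<Sum>i\<in>{0..<t}. W $$ (l, i) * x $ i) ^ 2)" by (intro sum_nonneg) simp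
  also have "\<dots> = (\<Sum>l<n. \<Sum>i\<in>{0..<t}. \<Sum>j\<in>{0..<t}. x $ i * (W $$ (l, i) * W $$ (l, j)) * x $ j)"
    by (simp add: power2_eq_square sum_product mult_ac)
  also have "\<dots> = (\<Sum>i\<in>{0..<t}. \<Sum>l<n. \<Sum>j\<in>{0..<t}. x $ i * (W $$ (l, i) * W $$ (l, j)) * x $ j)"
    by (rule sum.swap)
  also have "\<dots> = (\<Sum>i\<in>{0..<t}. \<Sum>j\<in>{0..<t}. \<Sum>l<n. x $ i * (W $$ (l, i) * W $$ (l, j)) * x $ j)"
    by (intro sum.cong refl sum.swap)
  also have "\<dots> = (\<Sum>i\<in>{0..<t}. \<Sum>j\<in>{0..<t}. x $ i * (transpose_mat W * W) $$ (i, j) * x $ j)"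
    using W by (intro sum.cong refl) (simp add: index_gram_mat_sum sum_distrib_left sum_distrib_right del: index_mult_mat(1))
  finally show "0 \<le> \<dots>" .
qed (use W in auto)

lemma mat_trace_diff:
  assumes "dim_row A = n" "dim_col A = n" "dim_row B = n" "dim_col B = n"
  shows "mat_trace (A - B) = mat_trace A - mat_trace B"
  using assms unfolding mat_trace_def by (simp add: sum_subtractf)

context
  fixes X R X1 :: "real mat" and n m q :: nat
  assumes X: "X \<in> carrier_mat n m" and R: "R \<in> carrier_mat n n" and X1: "X1 \<in> carrier_mat n q"
    and R_sym: "transpose_mat R = R" and R_idem: "R * R = R"
    and QR: "proj_perp X * R = proj_perp X"
begin

text \<open>$R - \mathrm{pr}^\perp_X$ is again an orthogonal projector.\<close>
lemma trace_proj_perp_le: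
  "mat_trace (transpose_mat X1 * proj_perp X * X1) \<le> mat_trace (transpose_mat X1 * R * X1)"
proof -
  let ?Q = "proj_perp X" let ?D = "R - ?Q" let ?W = "?D * X1"
  have d: "dim_row ?Q = n" "dim_col ?Q = n" "dim_row R = n" "dim_col R = n" "dim_row X1 = n" "dim_col X1 = q"
    using proj_perp_carrier[OF X] R X1 by auto
  note Qs = transpose_proj_perp[OF X] proj_perp_idem[OF X]
  \<comment> \<open>Transposing Q R = Q also gives R Q = Q, so all mixed products in (R - Q)^2
    collapse to Q.\<close>
  have "transpose_mat (?Q * R) = ?Q" unfolding QR Qs ..
  hence RQ: "R * ?Q = ?Q" using d by (simp add: transpose_mult_mat R_sym Qs)
  have "?D * ?D = R - ?Q - (?Q - ?Q)" using d by (simp add: diff_mult_mat mult_diff_mat R_idem RQ QR Qs)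
  also have "\<dots> = ?D" by (intro eq_matI) (use d in auto)
  finally have DD: "?D * ?D = ?D" .
  have Dt: "transpose_mat ?D = ?D" using d by (simp add: transpose_diff_mat R_sym Qs)
  have "transpose_mat ?W * ?W = transpose_mat X1 * (?D * ?D) * X1"
    using d by (simp add: transpose_mult_mat mult_mat_assoc Dt)
  also have "\<dots> = transpose_mat X1 * R * X1 - transpose_mat X1 * ?Q * X1"
    using d by (simp add: DD diff_mult_mat mult_diff_mat)
  finally have eq: "transpose_mat X1 * R * X1 - transpose_mat X1 * ?Q * X1 = transpose_mat ?W * ?W" ..
  have "nnd_sym q (transpose_mat ?W * ?W)" by (rule gram_nnd_sym[of _ n]) (use d in auto)
  hence "0 \<le> mat_trace (transpose_mat X1 * R * X1 - transpose_mat X1 * ?Q * X1)"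
    unfolding eq by (rule nnd_sym_trace_nonneg)
  thus ?thesis using d by (simp add: mat_trace_diff[of _ q])
qed

text \<open>Q X1 = Q R X1, and Q leaves R X1 unchanged because R X1 is orthogonal to every column of
  X. The matrix R will be the projector that removes block means.\<close>

lemma proj_perp_sandwich_eq:
  assumes "transpose_mat X * (R * X1) = 0\<^sub>m m q"
  shows "transpose_mat X1 * proj_perp X * X1 = transpose_mat X1 * R * X1"
proof -
  let ?Q = "proj_perp X"
  have d: "dim_row ?Q = n" "dim_col ?Q = n" "dim_row R = n" "dim_col R = n" "dim_row X1 = n" "dim_col X1 = q"
    "dim_row X = n" "dim_row (proj X) = n" "dim_col (proj X) = n"
    using proj_perp_carrier[OF X] R X1 X proj_carrier[OF X] by auto
  have "?Q * X1 = ?Q * (R * X1)" using d QR by (simp flip: mult_mat_assoc)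
  also have "\<dots> = R * X1 - proj X * (R * X1)"
    using d unfolding proj_perp_def by (simp add: diff_mult_mat)
  also have "proj X * (R * X1) = 0\<^sub>m n q" by (rule proj_mult_eq_zero[OF X]) (use R X1 assms in auto)
  also have "R * X1 - 0\<^sub>m n q = R * X1" by (intro eq_matI) (use d in auto)
  finally have "?Q * X1 = R * X1" .
  thus ?thesis using d by (simp add: mult_mat_assoc)
qed

end

lemma proj_perp_gram_nnd_sym:
  assumes X: "X \<in> carrier_mat n m" and X1: "X1 \<in> carrier_mat n q"
  shows "nnd_sym q (transpose_mat X1 * proj_perp X * X1)"
proof -
  have d: "proj_perp X \<in> carrier_mat n n" by (rule proj_perp_carrier[OF X])
  have "nnd_sym q (transpose_mat (proj_perp X * X1) * (proj_perp X * X1))"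
    by (rule gram_nnd_sym[of _ n]) (use d X1 in auto)
  also have "transpose_mat (proj_perp X * X1) * (proj_perp X * X1)
      = transpose_mat X1 * (proj_perp X * proj_perp X) * X1"
    using d X1 by (simp add: transpose_mult_mat mult_mat_assoc transpose_proj_perp[OF X])
  finally show ?thesis unfolding proj_perp_idem[OF X] .
qed

lemma sum_lessThan_add:
  fixes f :: "nat \<Rightarrow> 'a :: comm_monoid_add"
  shows "sum f {..<m + n} = sum f {..<m} + (\<Sum>i<n. f (m + i))"
  by (induction n) (auto simp: add.assoc)

text \<open>Decodes the flattened row index: sums over the b k rows become sums over blocks and
  plots.\<close>

lemma sum_div_mod:
  fixes g :: "nat \<Rightarrow> nat \<Rightarrow> 'a :: comm_monoid_add"
  assumes "0 < k"
  shows "(\<Sum>r<b * k. g (r div k + 1) (r mod k + 1)) = (\<Sum>i = 1..b. \<Sum>j = 1..k. g i j)"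
proof (induction b)
  case (Suc b)
  have "(\<Sum>r<Suc b * k. g (r div k + 1) (r mod k + 1))
      = (\<Sum>r<b * k + k. g (r div k + 1) (r mod k + 1))" by (simp add: add.commute)
  also have "\<dots> = (\<Sum>r<b * k. g (r div k + 1) (r mod k + 1)) + (\<Sum>j<k. g (b + 1) (j + 1))"
    unfolding sum_lessThan_add using assms by (intro arg_cong2[of _ _ _ _ "(+)"] sum.cong) auto
  also have "(\<Sum>j<k. g (b + 1) (j + 1)) = (\<Sum>j = 1..k. g (Suc b) j)"
    by (rule sum.reindex_bij_witness[of _ "\<lambda>j. j - 1" Suc]) auto
  finally show ?case using Suc by simp
qed simp

section \<open>Explicit forms of A K and A M\<close>

lemma K_mat_carrier: "K_mat t \<in> carrier_mat (2 * t) t"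
  unfolding K_mat_def by simp

text \<open>K stacks two identity matrices, so K'K = 2 I. This is the source of all the halves
  below.\<close>

lemma mp_inv_K_mat_gram:
  assumes t: "0 < t"
  shows "mp_inv (transpose_mat (K_mat t) * K_mat t) = (1 / 2) \<cdot>\<^sub>m 1\<^sub>m t"
proof (rule mp_inv_eqI)
  have "transpose_mat (K_mat t) * K_mat t = 2 \<cdot>\<^sub>m 1\<^sub>m t"
  proof (rule eq_matI)
    fix i j assume "i < dim_row (2 \<cdot>\<^sub>m 1\<^sub>m t :: real mat)" "j < dim_col (2 \<cdot>\<^sub>m 1\<^sub>m t :: real mat)"
    hence ij: "i < t" "j < t" by auto
    have "(transpose_mat (K_mat t) * K_mat t) $$ (i, j)
      = (\<Sum>l<t + t. (if l mod t = i then 1 else 0) * (if l mod t = j then 1 else 0))"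
      using ij K_mat_carrier[of t]
      by (subst index_gram_mat_sum) (auto simp: K_mat_def mult_2 intro!: sum.cong)
    also have "\<dots> = 2 * (\<Sum>l<t. if l = i then (if i = j then 1 else 0) else 0)"
      unfolding sum_lessThan_add mult_2 using t by (intro arg_cong2[of _ _ _ _ "(+)"] sum.cong) auto
    also have "\<dots> = (2 \<cdot>\<^sub>m 1\<^sub>m t) $$ (i, j)" using ij by simp
    finally show "(transpose_mat (K_mat t) * K_mat t) $$ (i, j) = (2 \<cdot>\<^sub>m 1\<^sub>m t) $$ (i, j)" .
  qed (use K_mat_carrier[of t] in auto)
  moreover have smult_one_mult: "(a \<cdot>\<^sub>m 1\<^sub>m t) * (c \<cdot>\<^sub>m 1\<^sub>m t) = (a * c) \<cdot>\<^sub>m 1\<^sub>m t" for a c :: real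
    by (rule eq_matI) (auto simp: smult_mult_mat mult_smult_mat)
  have "transpose_mat (1\<^sub>m t :: real mat) = 1\<^sub>m t" by simp
  moreover have "(1 :: real) \<cdot>\<^sub>m 1\<^sub>m t = 1\<^sub>m t" by (rule eq_matI) auto
  ultimately show "is_mp_inv (transpose_mat (K_mat t) * K_mat t) ((1 / 2) \<cdot>\<^sub>m 1\<^sub>m t)"
    unfolding is_mp_inv_def by (simp add: smult_one_mult)
qed

lemma mult_smult_one_mat:
  fixes A :: "real mat"
  shows "dim_col A = n \<Longrightarrow> A * (c \<cdot>\<^sub>m 1\<^sub>m n) = c \<cdot>\<^sub>m A"
  by (simp add: mult_smult_mat)

lemma A_mat_carrier: "A_mat t b k d \<in> carrier_mat (b * k) (2 * t)"
  unfolding A_mat_def by simp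

lemma A_mat_mult_K_mat:
  assumes t: "0 < t" and r: "r < b * k" and c: "c < t"
  shows "(A_mat t b k d * K_mat t) $$ (r, c) = T_mat t b k d $$ (r, c) + L_mat t b k d $$ (r, c)"
proof -
  have "(A_mat t b k d * K_mat t) $$ (r, c)
      = (\<Sum>s<t + t. A_mat t b k d $$ (r, s) * (if s mod t = c then 1 else 0))"
    using r c A_mat_carrier[of t b k d] K_mat_carrier[of t]
    by (subst index_mult_mat_sum) (auto simp: K_mat_def mult_2 intro!: sum.cong)
  also have "\<dots> = (\<Sum>s<t. if s = c then T_mat t b k d $$ (r, s) else 0)
      + (\<Sum>s<t. if s = c then L_mat t b k d $$ (r, s) else 0)"
    unfolding sum_lessThan_add using t r c
    by (intro arg_cong2[of _ _ _ _ "(+)"] sum.cong) (auto simp: A_mat_def)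
  finally show ?thesis using c by simp
qed

text \<open>M = I - K K'/2 subtracts from each column of A the mean of the two columns of the same
  treatment, which sit at c mod t and c mod t + t.\<close>

lemma A_mat_mult_M_mat:
  assumes t: "0 < t" and r: "r < b * k" and c: "c < 2 * t"
  shows "(A_mat t b k d * M_mat t) $$ (r, c)
    = A_mat t b k d $$ (r, c) - (T_mat t b k d $$ (r, c mod t) + L_mat t b k d $$ (r, c mod t)) / 2"
proof -
  let ?A = "A_mat t b k d" and ?K = "K_mat t"
  have d: "dim_row ?A = b * k" "dim_col ?A = 2 * t" "dim_row ?K = 2 * t" "dim_col ?K = t"
    using A_mat_carrier[of t b k d] K_mat_carrier[of t] by auto
  have "M_mat t = 1\<^sub>m (2 * t) - (1 / 2) \<cdot>\<^sub>m ?K * transpose_mat ?K"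
    unfolding M_mat_def mp_inv_K_mat_gram[OF t] using d by (simp add: mult_smult_one_mat)
  hence "?A * M_mat t = ?A - (1 / 2) \<cdot>\<^sub>m (?A * ?K) * transpose_mat ?K"
    using d A_mat_carrier[of t b k d] K_mat_carrier[of t]
    by (simp add: mult_diff_mat mult_smult_mat flip: mult_mat_assoc)
  hence "(?A * M_mat t) $$ (r, c) = ?A $$ (r, c) - ((1 / 2) \<cdot>\<^sub>m (?A * ?K) * transpose_mat ?K) $$ (r, c)"
    using r c d by simp
  also have "((1 / 2) \<cdot>\<^sub>m (?A * ?K) * transpose_mat ?K) $$ (r, c)
     = (\<Sum>l<t. (?A * ?K) $$ (r, l) / 2 * (if c mod t = l then 1 else 0))"
    using r c d by (subst index_mult_mat_sum) (auto simp: K_mat_def simp del: index_mult_mat(1) intro!: sum.cong)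
  also have "\<dots> = (\<Sum>l<t. if l = c mod t then (?A * ?K) $$ (r, l) / 2 else 0)"
    by (intro sum.cong) auto
  also have "\<dots> = (?A * ?K) $$ (r, c mod t) / 2" using t by simp
  finally show ?thesis using A_mat_mult_K_mat[OF t r, of "c mod t"] t by simp
qed

section \<open>Block sums and relabellings\<close>

text \<open>Entry of \<open>X1_mat\<close> in the row of plot $j$ of a block with inner sequence $l$.\<close>
definition mean_incidence :: "nat list \<Rightarrow> nat \<Rightarrow> nat \<Rightarrow> real" where
  "mean_incidence l j u = (of_bool (seq_at l j = u) + of_bool (seq_at l (j - 1) = u)) / 2"

definition diff_incidence :: "nat list \<Rightarrow> nat \<Rightarrow> nat \<Rightarrow> real" where
  "diff_incidence l j u = (of_bool (seq_at l j = u) - of_bool (seq_at l (j - 1) = u)) / 2"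

text \<open>Share of one block in X_1' R X_1, where R removes block means; the subtracted term is
  the correction for the block mean.\<close>

definition block_info :: "nat list \<Rightarrow> nat \<Rightarrow> nat \<Rightarrow> real" where
  "block_info l u v = (\<Sum>j = 1..length l. mean_incidence l j u * mean_incidence l j v)
     - real (n_occ l u) * real (n_occ l v) / real (length l)"

text \<open>Share of one block in (T - L)'(T + L)/4.\<close>

definition block_cross :: "nat list \<Rightarrow> nat \<Rightarrow> nat \<Rightarrow> real" where
  "block_cross l u v = (\<Sum>j = 1..length l. diff_incidence l j u * mean_incidence l j v)"

text \<open>Circularity in summed form: position 0 repeats the last position, so a shift by one plot
  only rearranges the terms.\<close>

lemma sum_seq_at_shift:
  fixes f :: "nat \<Rightarrow> 'b :: ab_group_add"
  shows "(\<Sum>j = 1..length l. f (seq_at l (j - 1))) = (\<Sum>j = 1..length l. f (seq_at l j))"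
proof (cases "l = []")
  case False
  have eq: "seq_at l (length l) = seq_at l 0"
    using False by (cases l rule: rev_cases) (auto simp: seq_at_def)
  have "(\<Sum>j = 1..length l. f (seq_at l (j - 1))) = (\<Sum>j<length l. f (seq_at l j))"
    by (rule sum.reindex_bij_witness[of _ Suc "\<lambda>j. j - 1"]) auto
  also have "\<dots> + f (seq_at l (length l)) = (\<Sum>j<Suc (length l). f (seq_at l j))" by simp
  also have "\<dots> = f (seq_at l 0) + (\<Sum>j<length l. f (seq_at l (Suc j)))"
    by (rule sum.lessThan_Suc_shift)
  also have "(\<Sum>j<length l. f (seq_at l (Suc j))) = (\<Sum>j = 1..length l. f (seq_at l j))"
    by (rule sum.reindex_bij_witness[of _ "\<lambda>j. j - 1" Suc]) auto
  finally show ?thesis by (simp add: eq add.commute)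
qed simp

lemma sum_incidence: "(\<Sum>j = 1..length l. of_bool (seq_at l j = u)) = real (n_occ l u)"
  unfolding n_occ_def by (simp add: of_bool_def sum.If_cases Int_def)

lemma sum_mean_incidence: "(\<Sum>j = 1..length l. mean_incidence l j u) = real (n_occ l u)"
  and sum_diff_incidence: "(\<Sum>j = 1..length l. diff_incidence l j u) = 0"
proof -
  have "(\<Sum>j = 1..length l. of_bool (seq_at l (j - 1) = u)) = real (n_occ l u)"
    using sum_seq_at_shift[of "\<lambda>x. of_bool (x = u) :: real" l] sum_incidence[of l u] by simp
  thus "(\<Sum>j = 1..length l. mean_incidence l j u) = real (n_occ l u)"
    and "(\<Sum>j = 1..length l. diff_incidence l j u) = 0"
    unfolding mean_incidence_def diff_incidence_def sum_divide_distrib[symmetric] sum.distrib sum_subtractf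
      sum_incidence by simp_all
qed

text \<open>For indicators a, a' of the current and b, b' of the preceding treatment, (a - b)(a' +
  b') + (a' - b')(a + b) = 2(aa' - bb'), which sums to zero around the circle.\<close>

lemma block_cross_antisym: "block_cross l u v = - block_cross l v u"
proof -
  let ?f = "\<lambda>x. of_bool (x = u) * of_bool (x = v) / 2 :: real"
  have "block_cross l u v + block_cross l v u
      = (\<Sum>j = 1..length l. ?f (seq_at l j) - ?f (seq_at l (j - 1)))"
    unfolding block_cross_def sum.distrib[symmetric] mean_incidence_def diff_incidence_def
    by (intro sum.cong) (auto simp: algebra_simps)
  also have "\<dots> = 0" unfolding sum_subtractf sum_seq_at_shift[of ?f] by simp
  finally show ?thesis by simp
qed

lemma sum_block_info_diag:
  assumes l: "l \<in> seqs t k" and k: "0 < k"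
  shows "(\<Sum>u = 1..t. block_info l u u) = c_val t l"
proof -
  have len: "length l = k" and sub: "set l \<subseteq> {1..t}" using l by (auto simp: seqs_def)
  \<comment> \<open>For 0/1 values a, b one has ((a + b)/2)^2 = (a + b)/4 + ab/2, and ab marks
    exactly the plots counted by m_u.\<close>
  have sq: "(\<Sum>j = 1..length l. mean_incidence l j u * mean_incidence l j u)
      = (real (n_occ l u) + real (m_occ l u)) / 2" for u
  proof -
    have m: "(\<Sum>j = 1..length l. of_bool (seq_at l (j - 1) = u \<and> seq_at l j = u)) = real (m_occ l u)"
      unfolding m_occ_def by (simp add: of_bool_def sum.If_cases Int_def del: of_bool_conj)
    have "(\<Sum>j = 1..length l. mean_incidence l j u * mean_incidence l j u)
      = (\<Sum>j = 1..length l. mean_incidence l j u / 2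
          + of_bool (seq_at l (j - 1) = u \<and> seq_at l j = u) / 2)"
      unfolding mean_incidence_def by (intro sum.cong) auto
    also have "\<dots> = (real (n_occ l u) + real (m_occ l u)) / 2"
      unfolding sum.distrib sum_divide_distrib[symmetric] sum_mean_incidence m by (simp add: add_divide_distrib)
    finally show ?thesis .
  qed
  have n: "(\<Sum>u = 1..t. real (n_occ l u)) = real k"
    using sum_n_occ[OF _ sub] len by (simp flip: of_nat_sum)
  have "(\<Sum>u = 1..t. block_info l u u) = ((\<Sum>u = 1..t. real (n_occ l u)) + (\<Sum>u = 1..t. real (m_occ l u))) / 2
     - (\<Sum>u = 1..t. real (n_occ l u) ^ 2) / real k"
    unfolding block_info_def sq unfolding sum_subtractf len power2_eq_square
    by (simp add: sum.distrib sum_divide_distrib[symmetric])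
  thus ?thesis unfolding n c_val_def len Let_def by (simp add: field_simps)
qed

lemma seq_at_map: "l \<noteq> [] \<Longrightarrow> j \<le> length l \<Longrightarrow> seq_at (map \<sigma> l) j = \<sigma> (seq_at l j)"
  by (auto simp: seq_at_def last_map)

lemma incidence_map:
  assumes "inj \<sigma>" "l \<noteq> []" "j \<le> length l"
  shows "mean_incidence (map \<sigma> l) j (\<sigma> u) = mean_incidence l j u"
    and "diff_incidence (map \<sigma> l) j (\<sigma> u) = diff_incidence l j u"
  using assms unfolding mean_incidence_def diff_incidence_def by (simp_all add: seq_at_map inj_eq)

lemma block_map:
  assumes "inj \<sigma>" "l \<noteq> []"
  shows "block_info (map \<sigma> l) (\<sigma> u) (\<sigma> v) = block_info l u v"
    and "block_cross (map \<sigma> l) (\<sigma> u) (\<sigma> v) = block_cross l u v"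
proof -
  have "real (n_occ (map \<sigma> l) (\<sigma> u)) = real (n_occ l u)" for u
    unfolding sum_mean_incidence[symmetric] using assms by (simp add: incidence_map)
  thus "block_info (map \<sigma> l) (\<sigma> u) (\<sigma> v) = block_info l u v"
    and "block_cross (map \<sigma> l) (\<sigma> u) (\<sigma> v) = block_cross l u v"
    using assms unfolding block_info_def block_cross_def by (simp_all add: incidence_map)
qed

lemma finite_relabellings: "finite (relabellings t l)"
proof -
  have "relabellings t l = (\<lambda>\<sigma>. map \<sigma> l) ` {\<sigma>. \<sigma> permutes {1..t}}"
    unfolding relabellings_def by auto
  thus ?thesis by (simp add: finite_permutations)
qed

lemma bij_betw_relabellings:
  assumes \<sigma>: "\<sigma> permutes {1..t}"
  shows "bij_betw (map \<sigma>) (relabellings t l) (relabellings t l)"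
  unfolding bij_betw_def
proof
  show inj: "inj_on (map \<sigma>) (relabellings t l)"
    using permutes_inj[OF \<sigma>] by (simp add: inj_on_def inj_map_eq_map)
  have "map \<sigma> ` relabellings t l \<subseteq> relabellings t l"
  proof (rule image_subsetI)
    fix s assume "s \<in> relabellings t l"
    then obtain \<rho> where "\<rho> permutes {1..t}" "s = map \<rho> l" unfolding relabellings_def by auto
    hence "\<sigma> \<circ> \<rho> permutes {1..t}" "map \<sigma> s = map (\<sigma> \<circ> \<rho>) l"
      using permutes_compose[OF _ \<sigma>] by auto
    thus "map \<sigma> s \<in> relabellings t l" unfolding relabellings_def by blast
  qed
  thus "map \<sigma> ` relabellings t l = relabellings t l"
    by (intro endo_inj_surj finite_relabellings inj)
qed

text \<open>Reindexing the orbit by the permutation moves the relabelling from the indices to the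
  sequences. With H a parameter, this yields both the symmetry of the information matrix and the
  vanishing of the cross terms.\<close>

lemma sum_relabellings_invariant:
  assumes H: "\<And>s \<sigma> u v. s \<noteq> [] \<Longrightarrow> inj \<sigma> \<Longrightarrow> H (map \<sigma> s) (\<sigma> u) (\<sigma> v) = H s u v"
    and l: "l \<noteq> []" and \<sigma>: "\<sigma> permutes {1..t}"
  shows "(\<Sum>s\<in>relabellings t l. H s (\<sigma> u) (\<sigma> v)) = (\<Sum>s\<in>relabellings t l. H s u v)"
proof -
  have "(\<Sum>s\<in>relabellings t l. H s (\<sigma> u) (\<sigma> v)) = (\<Sum>s\<in>relabellings t l. H (map \<sigma> s) (\<sigma> u) (\<sigma> v))"
    by (rule sum.reindex_bij_betw[OF bij_betw_relabellings[OF \<sigma>], symmetric])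
  also have "\<dots> = (\<Sum>s\<in>relabellings t l. H s u v)"
    using l permutes_inj[OF \<sigma>] by (intro sum.cong refl H) (auto simp: relabellings_def)
  finally show ?thesis .
qed

text \<open>Blocks are grouped by their inner sequence; here the equal frequencies of d* turn a sum
  over blocks into a sum over the orbit.\<close>

lemma sum_blocks_relabellings:
  fixes g :: "nat list \<Rightarrow> real"
  assumes "\<forall>i \<in> {1..b}. inner_seq k d i \<in> relabellings t l"
    and "\<forall>s \<in> relabellings t l. card {i \<in> {1..b}. inner_seq k d i = s} = r"
  shows "(\<Sum>i = 1..b. g (inner_seq k d i)) = real r * (\<Sum>s\<in>relabellings t l. g s)"
proof -
  have "(\<Sum>s\<in>relabellings t l. \<Sum>i\<in>{i \<in> {1..b}. inner_seq k d i = s}. g (inner_seq k d i))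
      = (\<Sum>i = 1..b. g (inner_seq k d i))"
    by (rule sum.group) (use assms(1) finite_relabellings in auto)
  moreover have "(\<Sum>i\<in>{i \<in> {1..b}. inner_seq k d i = s}. g (inner_seq k d i)) = real r * g s"
    if "s \<in> relabellings t l" for s
    using assms(2) that by (subst sum.cong[OF refl, of _ _ "\<lambda>_. g s"]) auto
  hence "(\<Sum>s\<in>relabellings t l. \<Sum>i\<in>{i \<in> {1..b}. inner_seq k d i = s}. g (inner_seq k d i))
      = (\<Sum>s\<in>relabellings t l. real r * g s)" by (rule sum.cong[OF refl])
  ultimately show ?thesis unfolding sum_distrib_left by (rule trans[OF sym])
qed

section \<open>Matrices of a circular design\<close>

context
  fixes t b k :: nat and d :: "nat \<Rightarrow> nat \<Rightarrow> nat"
  assumes t: "0 < t" and k: "0 < k" and d: "circular_design t b k d"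
begin

lemma length_inner_seq: "length (inner_seq k d i) = k"
  unfolding inner_seq_def by simp

text \<open>At j = 0 the convention l_0 = l_k matches the circularity of d, so the inner sequence
  also supplies the left border plot that \<open>L_mat\<close> needs.\<close>

lemma seq_at_inner_seq:
  assumes "i \<in> {1..b}" "j \<le> k"
  shows "seq_at (inner_seq k d i) j = d i j"
proof (cases j)
  case 0
  have "last (map (d i) [1..<k + 1]) = d i k" using k by simp
  thus ?thesis using 0 d assms unfolding seq_at_def inner_seq_def circular_design_def by simp
next
  case (Suc n)
  thus ?thesis using assms unfolding seq_at_def inner_seq_def by (simp del: upt_Suc)
qed

lemma inner_seq_seqs: "i \<in> {1..b} \<Longrightarrow> inner_seq k d i \<in> seqs t k"
  using d unfolding seqs_def inner_seq_def circular_design_def by auto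

lemma row_block: "r < b * k \<Longrightarrow> r div k + 1 \<in> {1..b}" and row_plot: "r mod k + 1 \<le> k"
  using k by (auto simp: less_mult_imp_div_less Suc_leI)

abbreviation (input) "sq r \<equiv> inner_seq k d (r div k + 1)"

lemma T_mat_index: "r < b * k \<Longrightarrow> c < t \<Longrightarrow>
    T_mat t b k d $$ (r, c) = of_bool (seq_at (sq r) (r mod k + 1) = c + 1)"
  and L_mat_index: "r < b * k \<Longrightarrow> c < t \<Longrightarrow>
    L_mat t b k d $$ (r, c) = of_bool (seq_at (sq r) (r mod k) = c + 1)"
  using seq_at_inner_seq[OF row_block, of r] row_plot[of r]
  unfolding T_mat_def L_mat_def by auto

lemma X1_mat_carrier: "X1_mat t b k d \<in> carrier_mat (b * k) t"
  unfolding X1_mat_def mp_inv_K_mat_gram[OF t]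
  using A_mat_carrier[of t b k d] K_mat_carrier[of t] by auto

lemma X1_mat_index:
  assumes "r < b * k" "c < t"
  shows "X1_mat t b k d $$ (r, c) = mean_incidence (sq r) (r mod k + 1) (c + 1)"
  unfolding X1_mat_def mp_inv_K_mat_gram[OF t] mean_incidence_def
  using assms A_mat_carrier[of t b k d] K_mat_carrier[of t]
  by (simp add: mult_smult_one_mat A_mat_mult_K_mat[OF t] T_mat_index L_mat_index del: index_mult_mat(1))

lemma AM_index:
  assumes "r < b * k" "c < 2 * t"
  shows "(A_mat t b k d * M_mat t) $$ (r, c)
    = (if c < t then 1 else -1) * diff_incidence (sq r) (r mod k + 1) (c mod t + 1)"
proof -
  have "c mod t = (if c < t then c else c - t)" using assms(2) by (simp add: mod_if)
  moreover have "c mod t < t" using t by simp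
  ultimately show ?thesis
    unfolding A_mat_mult_M_mat[OF t assms] diff_incidence_def
    using assms by (auto simp: A_mat_def T_mat_index L_mat_index field_simps)
qed

lemma B_mat_carrier: "B_mat b k \<in> carrier_mat (b * k) b"
  unfolding B_mat_def by simp

lemma X2_mat_carrier: "X2_mat t b k d \<in> carrier_mat (b * k) (2 * t + b)"
  unfolding X2_mat_def by simp

text \<open>Row i (from 0) of B' is the indicator of block i + 1, so this product totals a column
  over that block.\<close>

lemma mult_block_structure:
  fixes Z :: "real mat"
  assumes Z: "Z \<in> carrier_mat (b * k) p" and i: "i < b" and c: "c < p"
    and ent: "\<And>r. r < b * k \<Longrightarrow> Z $$ (r, c) = g (r div k + 1) (r mod k + 1)"
  shows "(transpose_mat (B_mat b k) * Z) $$ (i, c) = (\<Sum>j = 1..k. g (i + 1) j)"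
proof -
  have "(transpose_mat (B_mat b k) * Z) $$ (i, c)
    = (\<Sum>r<b * k. of_bool (r div k + 1 = i + 1) * g (r div k + 1) (r mod k + 1))"
    using Z i c B_mat_carrier ent by (subst index_gram_mat_sum) (auto simp: B_mat_def of_bool_def intro!: sum.cong)
  also have "\<dots> = (\<Sum>l = 1..b. \<Sum>j = 1..k. of_bool (l = i + 1) * g l j)"
    by (rule sum_div_mod[OF k])
  also have "\<dots> = (\<Sum>l = 1..b. if l = i + 1 then \<Sum>j = 1..k. g (i + 1) j else 0)"
    by (intro sum.cong) auto
  also have "\<dots> = (\<Sum>j = 1..k. g (i + 1) j)" using i by simp
  finally show ?thesis .
qed

lemma B_mat_gram: "transpose_mat (B_mat b k) * B_mat b k = real k \<cdot>\<^sub>m 1\<^sub>m b"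
proof (rule eq_matI)
  fix i c assume "i < dim_row (real k \<cdot>\<^sub>m 1\<^sub>m b)" "c < dim_col (real k \<cdot>\<^sub>m 1\<^sub>m b)"
  hence ic: "i < b" "c < b" by auto
  have "(transpose_mat (B_mat b k) * B_mat b k) $$ (i, c) = (\<Sum>j = 1..k. of_bool (i + 1 = c + 1))"
    using ic by (intro mult_block_structure[OF B_mat_carrier]) (auto simp: B_mat_def)
  thus "(transpose_mat (B_mat b k) * B_mat b k) $$ (i, c) = (real k \<cdot>\<^sub>m 1\<^sub>m b) $$ (i, c)"
    using ic by simp
qed (use B_mat_carrier in auto)


lemma B_mat_mult_X1_mat:
  assumes "i < b" "u < t"
  shows "(transpose_mat (B_mat b k) * X1_mat t b k d) $$ (i, u) = real (n_occ (inner_seq k d (i + 1)) (u + 1))"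
proof -
  have "(transpose_mat (B_mat b k) * X1_mat t b k d) $$ (i, u)
      = (\<Sum>j = 1..k. mean_incidence (inner_seq k d (i + 1)) j (u + 1))"
    using X1_mat_index[OF _ assms(2)] by (intro mult_block_structure[OF X1_mat_carrier assms]) auto
  thus ?thesis using sum_mean_incidence[of "inner_seq k d (i + 1)"] by (simp add: length_inner_seq)
qed

text \<open>Since B'B = k I, this is the projector orthogonal to the block columns, in closed form
  without a generalized inverse.\<close>

definition block_perp :: "real mat" where
  "block_perp = 1\<^sub>m (b * k) - (1 / real k) \<cdot>\<^sub>m (B_mat b k * transpose_mat (B_mat b k))"

lemma block_perp_carrier: "block_perp \<in> carrier_mat (b * k) (b * k)"
  unfolding block_perp_def using B_mat_carrier by auto

lemma transpose_block_perp: "transpose_mat block_perp = block_perp"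
proof -
  have "transpose_mat (c \<cdot>\<^sub>m A) = c \<cdot>\<^sub>m transpose_mat A" for c and A :: "real mat"
    by (intro eq_matI) auto
  thus ?thesis unfolding block_perp_def using B_mat_carrier by (simp add: transpose_diff_mat transpose_mult_mat)
qed

lemma mult_block_perp:
  assumes Z: "dim_col Z = b * k"
  shows "Z * block_perp = Z - (1 / real k) \<cdot>\<^sub>m (Z * B_mat b k * transpose_mat (B_mat b k))"
  unfolding block_perp_def using Z B_mat_carrier
  by (simp add: mult_diff_mat mult_smult_mat mult_mat_assoc)

text \<open>Used twice: with Z = \<open>block_perp\<close> it gives idempotence, and with Z the
  projector orthogonal to X_2 it gives the absorption law needed to compare the two
  adjustments.\<close>

lemma mult_block_perp_eq_self:
  assumes Z: "Z \<in> carrier_mat n (b * k)" and ZB: "Z * B_mat b k = 0\<^sub>m n b"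
  shows "Z * block_perp = Z"
proof -
  have "Z * block_perp = Z - (1 / real k) \<cdot>\<^sub>m (0\<^sub>m n b * transpose_mat (B_mat b k))"
    using Z by (simp add: mult_block_perp ZB)
  also have "0\<^sub>m n b * transpose_mat (B_mat b k) = 0\<^sub>m n (b * k)"
    using B_mat_carrier by (intro left_mult_zero_mat[of _ b]) auto
  finally show ?thesis using Z by (auto intro!: eq_matI)
qed

lemma block_perp_mult_B_mat: "block_perp * B_mat b k = 0\<^sub>m (b * k) b"
proof -
  have "block_perp * B_mat b k
      = B_mat b k - (1 / real k) \<cdot>\<^sub>m (B_mat b k * (transpose_mat (B_mat b k) * B_mat b k))"
    unfolding block_perp_def using B_mat_carrier
    by (simp add: diff_mult_mat smult_mult_mat mult_mat_assoc)
  also have "\<dots> = 0\<^sub>m (b * k) b"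
    unfolding B_mat_gram using B_mat_carrier k by (auto simp: mult_smult_one_mat intro!: eq_matI)
  finally show ?thesis .
qed

lemma block_perp_idem: "block_perp * block_perp = block_perp"
  by (rule mult_block_perp_eq_self[OF block_perp_carrier block_perp_mult_B_mat])

lemma X2_mat_index:
  assumes "r < b * k"
  shows "c < 2 * t \<Longrightarrow> X2_mat t b k d $$ (r, c)
      = (if c < t then 1 else -1) * diff_incidence (sq r) (r mod k + 1) (c mod t + 1)"
    and "i < b \<Longrightarrow> X2_mat t b k d $$ (r, 2 * t + i) = B_mat b k $$ (r, i)"
  using assms AM_index[OF assms] unfolding X2_mat_def by (auto simp del: index_mult_mat(1))

text \<open>The columns of B are the last b columns of X_2, which the projector annihilates.\<close>

lemma proj_perp_X2_mult_B_mat: "proj_perp (X2_mat t b k d) * B_mat b k = 0\<^sub>m (b * k) b"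
proof (rule eq_matI)
  fix r i assume "r < dim_row (0\<^sub>m (b * k) b :: real mat)" "i < dim_col (0\<^sub>m (b * k) b :: real mat)"
  hence ri: "r < b * k" "i < b" by auto
  let ?Q = "proj_perp (X2_mat t b k d)"
  have Q: "?Q \<in> carrier_mat (b * k) (b * k)" by (rule proj_perp_carrier[OF X2_mat_carrier])
  have "(?Q * B_mat b k) $$ (r, i) = (\<Sum>l<b * k. ?Q $$ (r, l) * B_mat b k $$ (l, i))"
    using ri Q B_mat_carrier by (subst index_mult_mat_sum) auto
  also have "\<dots> = (\<Sum>l<b * k. ?Q $$ (r, l) * X2_mat t b k d $$ (l, 2 * t + i))"
    using ri by (intro sum.cong) (auto simp: X2_mat_index(2))
  also have "\<dots> = (?Q * X2_mat t b k d) $$ (r, 2 * t + i)"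
    using ri Q X2_mat_carrier by (subst index_mult_mat_sum) auto
  also have "\<dots> = 0" using ri by (simp add: proj_perp_mult_self[OF X2_mat_carrier])
  finally show "(?Q * B_mat b k) $$ (r, i) = 0\<^sub>m (b * k) b $$ (r, i)" using ri by simp
qed (use proj_perp_carrier[OF X2_mat_carrier] B_mat_carrier in auto)

lemma proj_perp_X2_mult_block_perp:
  "proj_perp (X2_mat t b k d) * block_perp = proj_perp (X2_mat t b k d)"
  by (rule mult_block_perp_eq_self[OF proj_perp_carrier[OF X2_mat_carrier] proj_perp_X2_mult_B_mat])

text \<open>With N = B'X_1, the matrix of treatment counts per block, the product equals X_1'X_1 -
  N'N/k, and both terms split over the blocks.\<close>

lemma block_perp_sandwich_index:
  assumes uv: "u < t" "v < t"
  shows "(transpose_mat (X1_mat t b k d) * block_perp * X1_mat t b k d) $$ (u, v)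
    = (\<Sum>i = 1..b. block_info (inner_seq k d i) (u + 1) (v + 1))"
proof -
  let ?X = "X1_mat t b k d" and ?B = "B_mat b k"
  let ?N = "transpose_mat ?B * ?X"
  have dims: "dim_row ?X = b * k" "dim_col ?X = t" "dim_row ?B = b * k" "dim_col ?B = b"
    using X1_mat_carrier B_mat_carrier by auto
  have "transpose_mat ?X * block_perp * ?X
    = transpose_mat ?X * ?X - (1 / real k) \<cdot>\<^sub>m (transpose_mat ?N * ?N)"
    using dims by (simp add: mult_block_perp diff_mult_mat transpose_mult_mat mult_mat_assoc
      smult_mult_mat)
  hence "(transpose_mat ?X * block_perp * ?X) $$ (u, v)
    = (transpose_mat ?X * ?X) $$ (u, v) - (transpose_mat ?N * ?N) $$ (u, v) / real k"
    using uv dims by (simp del: index_mult_mat(1))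
  also have "(transpose_mat ?X * ?X) $$ (u, v)
    = (\<Sum>r<b * k. mean_incidence (sq r) (r mod k + 1) (u + 1) * mean_incidence (sq r) (r mod k + 1) (v + 1))"
    using uv dims by (subst index_gram_mat_sum) (auto simp: X1_mat_index)
  also have "\<dots> = (\<Sum>i = 1..b. \<Sum>j = 1..k. mean_incidence (inner_seq k d i) j (u + 1)
      * mean_incidence (inner_seq k d i) j (v + 1))"
    by (rule sum_div_mod[OF k])
  also have "(transpose_mat ?N * ?N) $$ (u, v)
    = (\<Sum>i<b. real (n_occ (inner_seq k d (i + 1)) (u + 1)) * real (n_occ (inner_seq k d (i + 1)) (v + 1)))"
    using uv dims B_mat_mult_X1_mat
    by (subst index_gram_mat_sum) (auto simp del: index_mult_mat(1) intro!: sum.cong)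
  also have "\<dots> = (\<Sum>i = 1..b. real (n_occ (inner_seq k d i) (u + 1)) * real (n_occ (inner_seq k d i) (v + 1)))"
    by (rule sum.reindex_bij_witness[of _ "\<lambda>i. i - 1" Suc]) auto
  finally show ?thesis
    unfolding block_info_def length_inner_seq sum_subtractf sum_divide_distrib .
qed

lemma trace_block_perp_sandwich:
  "mat_trace (transpose_mat (X1_mat t b k d) * block_perp * X1_mat t b k d)
    = (\<Sum>i = 1..b. c_val t (inner_seq k d i))"
proof -
  have "mat_trace (transpose_mat (X1_mat t b k d) * block_perp * X1_mat t b k d)
    = (\<Sum>u<t. \<Sum>i = 1..b. block_info (inner_seq k d i) (u + 1) (u + 1))"
    using block_perp_sandwich_index X1_mat_carrier unfolding mat_trace_def
    by (auto simp del: index_mult_mat(1) intro!: sum.cong)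
  also have "\<dots> = (\<Sum>i = 1..b. \<Sum>u<t. block_info (inner_seq k d i) (u + 1) (u + 1))"
    by (rule sum.swap)
  also have "\<dots> = (\<Sum>i = 1..b. \<Sum>u = 1..t. block_info (inner_seq k d i) u u)"
    by (intro sum.cong refl sum.reindex_bij_witness[of _ "\<lambda>i. i - 1" Suc]) auto
  also have "\<dots> = (\<Sum>i = 1..b. c_val t (inner_seq k d i))"
    using inner_seq_seqs k by (intro sum.cong refl sum_block_info_diag)
  finally show ?thesis .
qed

lemma info_mat_nnd_sym: "nnd_sym t (info_mat t b k d)"
  unfolding info_mat_def by (rule proj_perp_gram_nnd_sym[OF X2_mat_carrier X1_mat_carrier])

lemma trace_info_mat_le: "mat_trace (info_mat t b k d) \<le> (\<Sum>i = 1..b. c_val t (inner_seq k d i))"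
  unfolding info_mat_def trace_block_perp_sandwich[symmetric]
  by (rule trace_proj_perp_le[OF X2_mat_carrier block_perp_carrier X1_mat_carrier
    transpose_block_perp block_perp_idem proj_perp_X2_mult_block_perp])

text \<open>$X_1 1_t = 1_{bk} = B 1_b$ lies in the column space of $X_2$.\<close>
lemma info_mat_row_sum:
  assumes i: "i < t"
  shows "(\<Sum>j\<in>{0..<t}. info_mat t b k d $$ (i, j)) = 0"
proof -
  let ?X = "X1_mat t b k d" and ?B = "B_mat b k" and ?Q = "proj_perp (X2_mat t b k d)"
  let ?J = "\<lambda>n. mat n 1 (\<lambda>_. 1) :: real mat"
  have dims: "dim_row ?X = b * k" "dim_col ?X = t" "dim_row ?B = b * k" "dim_col ?B = b"
    "dim_row ?Q = b * k" "dim_col ?Q = b * k"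
    using X1_mat_carrier B_mat_carrier proj_perp_carrier[OF X2_mat_carrier] by auto
  have "?X * ?J t = ?B * ?J b"
  proof (rule eq_matI)
    fix r c assume "r < dim_row (?B * ?J b)" "c < dim_col (?B * ?J b)"
    hence rc: "r < b * k" "c = 0" using dims by auto
    let ?l = "inner_seq k d (r div k + 1)"
    have rb: "r div k + 1 \<in> {1..b}" by (rule row_block[OF rc(1)])
    have range: "seq_at ?l j \<in> {1..t}" if "j \<le> k" for j
      unfolding seq_at_inner_seq[OF rb that] using d rb that unfolding circular_design_def by auto
    have one: "(\<Sum>c<t. of_bool (x = c + 1)) = (1 :: real)" if "x \<in> {1..t}" for x
    proof -
      have "(\<Sum>c<t. of_bool (x = c + 1)) = (\<Sum>c<t. if c = x - 1 then 1 else 0 :: real)"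
        using that by (intro sum.cong) auto
      moreover have "x - 1 < t" using that by auto
      ultimately show ?thesis by (simp only: sum.delta finite_lessThan lessThan_iff if_True)
    qed
    have "(?X * ?J t) $$ (r, c) = (\<Sum>c<t. mean_incidence ?l (r mod k + 1) (c + 1))"
      using rc dims by (subst index_mult_mat_sum) (auto simp: X1_mat_index)
    also have "\<dots> = 1"
      unfolding mean_incidence_def sum_divide_distrib[symmetric] sum.distrib
      using row_plot[of r] one[OF range[of "r mod k + 1"]] one[OF range[of "r mod k"]] by simp
    also have "\<dots> = (\<Sum>i<b. if i = r div k then 1 else 0)" using rb by simp
    also have "\<dots> = (?B * ?J b) $$ (r, c)"
      using rc dims by (subst index_mult_mat_sum) (auto simp: B_mat_def intro!: sum.cong)
    finally show "(?X * ?J t) $$ (r, c) = (?B * ?J b) $$ (r, c)" .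
  qed (use dims in auto)
  hence "info_mat t b k d * ?J t = transpose_mat ?X * (?Q * ?B * ?J b)"
    unfolding info_mat_def using dims by (simp add: mult_mat_assoc)
  also have "\<dots> = 0\<^sub>m t 1" unfolding proj_perp_X2_mult_B_mat using dims by simp
  finally have "(info_mat t b k d * ?J t) $$ (i, 0) = 0" using i by simp
  thus ?thesis
    using i info_mat_nnd_sym unfolding nnd_sym_def
    by (subst (asm) index_mult_mat_sum) (auto simp: atLeast0LessThan)
qed

text \<open>With vanishing cross terms $T_d - L_d$ is orthogonal to both $B$ and $T_d + L_d$, so
  adjusting for $X_2$ amounts to adjusting for the blocks.\<close>
lemma info_mat_eq_block_perp_sandwich:
  assumes cross: "\<And>u v. u \<in> {1..t} \<Longrightarrow> v \<in> {1..t} \<Longrightarrow> (\<Sum>i = 1..b. block_cross (inner_seq k d i) u v) = 0"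
  shows "info_mat t b k d = transpose_mat (X1_mat t b k d) * block_perp * X1_mat t b k d"
  unfolding info_mat_def
proof (rule proj_perp_sandwich_eq[OF X2_mat_carrier block_perp_carrier X1_mat_carrier
    transpose_block_perp block_perp_idem proj_perp_X2_mult_block_perp])
  let ?X = "X1_mat t b k d" and ?B = "B_mat b k" and ?X2 = "X2_mat t b k d"
  let ?N = "transpose_mat ?B * ?X"
  have dims: "dim_row ?X = b * k" "dim_col ?X = t" "dim_row ?B = b * k" "dim_col ?B = b"
    "dim_row ?X2 = b * k" "dim_col ?X2 = 2 * t + b" "dim_row block_perp = b * k" "dim_col block_perp = b * k"
    using X1_mat_carrier B_mat_carrier X2_mat_carrier block_perp_carrier by auto
  show "transpose_mat ?X2 * (block_perp * ?X) = 0\<^sub>m (2 * t + b) t"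
  proof (rule eq_matI)
    fix c v assume "c < dim_row (0\<^sub>m (2 * t + b) t :: real mat)" "v < dim_col (0\<^sub>m (2 * t + b) t :: real mat)"
    hence cv: "c < 2 * t + b" "v < t" by auto
    have "(transpose_mat ?X2 * (block_perp * ?X)) $$ (c, v) = 0"
    proof (cases "c < 2 * t")
      case True
      let ?e = "if c < t then 1 else -1 :: real"
      \<comment> \<open>In a circular block each treatment is current as often as preceding, so T -
        L has zero block totals and the correction for block means drops out.\<close>
      have BX2: "(transpose_mat ?B * ?X2) $$ (i, c) = 0" if "i < b" for i
      proof -
        have "(transpose_mat ?B * ?X2) $$ (i, c)
          = (\<Sum>j = 1..k. ?e * diff_incidence (inner_seq k d (i + 1)) j (c mod t + 1))"
          using X2_mat_index(1)[OF _ True] cv by (intro mult_block_structure[OF X2_mat_carrier that]) auto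
        also have "\<dots> = 0"
          unfolding sum_distrib_left[symmetric]
          using sum_diff_incidence[of "inner_seq k d (i + 1)"] by (simp add: length_inner_seq)
        finally show ?thesis .
      qed
      have "(transpose_mat ?X2 * ?X) $$ (c, v)
        = (\<Sum>r<b * k. ?e * diff_incidence (sq r) (r mod k + 1) (c mod t + 1)
            * mean_incidence (sq r) (r mod k + 1) (v + 1))"
        using cv True dims by (subst index_gram_mat_sum) (auto simp: X1_mat_index X2_mat_index(1))
      also have "\<dots> = (\<Sum>i = 1..b. \<Sum>j = 1..k. ?e * diff_incidence (inner_seq k d i) j (c mod t + 1)
            * mean_incidence (inner_seq k d i) j (v + 1))"
        by (rule sum_div_mod[OF k])
      also have "\<dots> = ?e * (\<Sum>i = 1..b. block_cross (inner_seq k d i) (c mod t + 1) (v + 1))"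
        unfolding block_cross_def length_inner_seq sum_distrib_left by (simp add: mult.assoc)
      finally have 1: "(transpose_mat ?X2 * ?X) $$ (c, v) = 0"
        using cross[of "c mod t + 1" "v + 1"] cv t by (simp add: Suc_le_eq)
      have 2: "(transpose_mat (transpose_mat ?B * ?X2) * ?N) $$ (c, v) = 0"
        using cv dims BX2 by (subst index_gram_mat_sum) (auto simp del: index_mult_mat(1))
      have "transpose_mat ?X2 * (block_perp * ?X) = transpose_mat ?X2 * block_perp * ?X"
        using dims by (simp add: mult_mat_assoc)
      also have "\<dots> = transpose_mat ?X2 * ?X
          - (1 / real k) \<cdot>\<^sub>m (transpose_mat (transpose_mat ?B * ?X2) * ?N)"
        using dims by (simp add: mult_block_perp diff_mult_mat transpose_mult_mat mult_mat_assoc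
          smult_mult_mat)
      finally show ?thesis using 1 2 cv dims by (simp del: index_mult_mat(1))
    next
      case False
      define i where "i = c - 2 * t"
      have i: "i < b" "c = 2 * t + i" using cv False unfolding i_def by auto
      have "(transpose_mat ?X2 * (block_perp * ?X)) $$ (c, v)
        = (\<Sum>l<b * k. ?B $$ (l, i) * (block_perp * ?X) $$ (l, v))"
        using cv i dims by (subst index_gram_mat_sum)
          (auto simp: X2_mat_index(2) simp del: index_mult_mat(1) intro!: sum.cong)
      also have "\<dots> = (transpose_mat ?B * (block_perp * ?X)) $$ (i, v)"
        using cv i dims by (subst index_gram_mat_sum) (auto simp del: index_mult_mat(1))
      also have "transpose_mat ?B * (block_perp * ?X) = transpose_mat (block_perp * ?B) * ?X"
        using dims by (simp add: transpose_mult_mat transpose_block_perp mult_mat_assoc)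
      also have "\<dots> = 0\<^sub>m b t" unfolding block_perp_mult_B_mat using dims by simp
      finally show ?thesis using i cv by simp
    qed
    thus "(transpose_mat ?X2 * (block_perp * ?X)) $$ (c, v) = 0\<^sub>m (2 * t + b) t $$ (c, v)" using cv by simp
  qed (use dims in auto)
qed

end

text \<open>The transposition of u and v maps the orbit to itself, so the sum is symmetric in u and
  v; it is also antisymmetric, hence zero.\<close>

lemma sum_block_cross_relabellings:
  assumes l: "l \<noteq> []" and uv: "u \<in> {1..t}" "v \<in> {1..t}"
  shows "(\<Sum>s\<in>relabellings t l. block_cross s u v) = 0"
proof -
  let ?G = "\<lambda>u v. \<Sum>s\<in>relabellings t l. block_cross s u v"
  have "?G u v = - ?G v u"
    unfolding sum_negf[symmetric] by (intro sum.cong refl block_cross_antisym)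
  moreover have "?G (transpose u v u) (transpose u v v) = ?G u v"
    by (rule sum_relabellings_invariant[OF _ l permutes_swap_id[OF uv]]) (rule block_map(2))
  ultimately show ?thesis by simp
qed

text \<open>Matrix indices start at 0 and treatment labels at 1; this carries a permutation of
  indices over to labels.\<close>

lemma permutes_shift:
  fixes t :: nat
  assumes p: "\<pi> permutes {0..<t}"
  defines "\<sigma> \<equiv> \<lambda>x. if x \<in> {1..t} then \<pi> (x - 1) + 1 else x"
  shows "\<sigma> permutes {1..t}"
proof (rule bij_imp_permutes)
  have lt: "\<pi> i < t" if "i < t" for i using permutes_in_image[OF p, of i] that by simp
  have "inj_on \<sigma> {1..t}"
    unfolding \<sigma>_def inj_on_def using inj_eq[OF permutes_inj[OF p]] by (auto simp: Suc_pred)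
  moreover have "\<sigma> ` {1..t} \<subseteq> {1..t}" using lt unfolding \<sigma>_def by (force simp: Suc_le_eq)
  ultimately show "bij_betw \<sigma> {1..t} {1..t}" unfolding bij_betw_def by (simp add: endo_inj_surj)
qed (auto simp: \<sigma>_def)

text \<open>c is the trace of \<open>block_info\<close>, so invariance reduces to reindexing a sum
  over treatments.\<close>

lemma c_val_map:
  assumes \<sigma>: "\<sigma> permutes {1..t}" and l: "l \<in> seqs t k" and k: "0 < k"
  shows "map \<sigma> l \<in> seqs t k" and "c_val t (map \<sigma> l) = c_val t l"
proof -
  have ne: "l \<noteq> []" using l k by (auto simp: seqs_def)
  show m: "map \<sigma> l \<in> seqs t k" using l permutes_image[OF \<sigma>] by (auto simp: seqs_def)
  have "c_val t (map \<sigma> l) = (\<Sum>u = 1..t. block_info (map \<sigma> l) u u)"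
    by (rule sum_block_info_diag[OF m k, symmetric])
  also have "\<dots> = (\<Sum>u = 1..t. block_info (map \<sigma> l) (\<sigma> u) (\<sigma> u))"
    using sum.permute[OF \<sigma>, of "\<lambda>u. block_info (map \<sigma> l) u u"] by (simp add: o_def)
  also have "\<dots> = c_val t l"
    unfolding block_map(1)[OF permutes_inj[OF \<sigma>] ne] by (rule sum_block_info_diag[OF l k])
  finally show "c_val t (map \<sigma> l) = c_val t l" .
qed

theorem theorem10:
  fixes t b k :: nat and lstar :: "nat list" and dstar :: "nat \<Rightarrow> nat \<Rightarrow> nat"
  assumes "0 < t" "0 < b" "0 < k" "3 \<le> k" "k \<le> t"
    and "lstar \<in> seqs t k"
    and "\<forall>l \<in> seqs t k. c_val t l \<le> c_val t lstar"
    and "circular_design t b k dstar"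
    and "\<forall>i \<in> {1..b}. inner_seq k dstar i \<in> relabellings t lstar"
    and "\<exists>r. \<forall>s \<in> relabellings t lstar. card {i \<in> {1..b}. inner_seq k dstar i = s} = r"
  shows "universally_optimal t b k dstar {d. circular_design t b k d}
     \<and> mat_trace (info_mat t b k dstar) = real b * f_val k (card (set lstar))
     \<and> real b * f_val k (card (set lstar)) = real b * c_val t lstar"
proof -
  note t = \<open>0 < t\<close> and k = \<open>0 < k\<close> and l = \<open>lstar \<in> seqs t k\<close>
    and max = \<open>\<forall>l \<in> seqs t k. c_val t l \<le> c_val t lstar\<close>
    and d = \<open>circular_design t b k dstar\<close>
    and rel = \<open>\<forall>i \<in> {1..b}. inner_seq k dstar i \<in> relabellings t lstar\<close>
  obtain r where r: "\<forall>s \<in> relabellings t lstar. card {i \<in> {1..b}. inner_seq k dstar i = s} = r"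
    using assms(10) by blast
  note sum_rel = sum_blocks_relabellings[OF rel r]
  have ne: "lstar \<noteq> []" using l k by (auto simp: seqs_def)
  let ?C = "info_mat t b k"
  let ?S = "transpose_mat (X1_mat t b k dstar) * block_perp b k * X1_mat t b k dstar"
  have C: "?C dstar = ?S"
  proof (rule info_mat_eq_block_perp_sandwich[OF t k d])
    fix u v assume "u \<in> {1..t}" "v \<in> {1..t}"
    thus "(\<Sum>i = 1..b. block_cross (inner_seq k dstar i) u v) = 0"
      unfolding sum_rel[of "\<lambda>s. block_cross s u v"] by (simp add: sum_block_cross_relabellings[OF ne])
  qed
  have C_index: "?C dstar $$ (u, v) = real r * (\<Sum>s\<in>relabellings t lstar. block_info s (u + 1) (v + 1))"
    if "u < t" "v < t" for u v
    unfolding C block_perp_sandwich_index[OF t k d that]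
    by (rule sum_rel[of "\<lambda>s. block_info s (u + 1) (v + 1)"])
  have inv: "?C dstar $$ (\<pi> u, \<pi> v) = ?C dstar $$ (u, v)"
    if p: "\<pi> permutes {0..<t}" and uv: "u < t" "v < t" for \<pi> u v
  proof -
    define \<sigma> where "\<sigma> = (\<lambda>x. if x \<in> {1..t} then \<pi> (x - 1) + 1 else x)"
    have \<sigma>: "\<sigma> permutes {1..t}" unfolding \<sigma>_def by (rule permutes_shift[OF p])
    have lt: "\<pi> i < t" if "i < t" for i using permutes_in_image[OF p, of i] that by simp
    have shift: "\<pi> u + 1 = \<sigma> (u + 1)" "\<pi> v + 1 = \<sigma> (v + 1)" using uv unfolding \<sigma>_def by auto
    show ?thesis
      unfolding C_index[OF lt[OF uv(1)] lt[OF uv(2)]] C_index[OF uv] shift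
      by (subst sum_relabellings_invariant[OF _ ne \<sigma>]) (auto simp: block_map(1))
  qed
  have "c_val t (inner_seq k dstar i) = c_val t lstar" if "i \<in> {1..b}" for i
  proof -
    obtain \<sigma> where "\<sigma> permutes {1..t}" "inner_seq k dstar i = map \<sigma> lstar"
      using rel \<open>i \<in> {1..b}\<close> unfolding relabellings_def by blast
    thus ?thesis using c_val_map(2)[OF _ l k] by simp
  qed
  hence tr: "mat_trace (?C dstar) = real b * c_val t lstar"
    unfolding C trace_block_perp_sandwich[OF t k d] by simp
  have pos: "0 < c_val t lstar" by (rule c_val_maximal_pos[OF \<open>3 \<le> k\<close> \<open>k \<le> t\<close> max])
  have f: "c_val t lstar = f_val k (card (set lstar))"
    by (rule c_val_maximal_eq_f_val[OF \<open>3 \<le> k\<close> \<open>k \<le> t\<close> l max])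
  have "universally_optimal t b k dstar {d. circular_design t b k d}"
    unfolding universally_optimal_def
  proof (intro allI impI ballI)
    fix \<Phi> d assume \<Phi>: "admissible_criterion t \<Phi>" and "d \<in> {d. circular_design t b k d}"
    hence d': "circular_design t b k d" by simp
    have "mat_trace (?C d) \<le> (\<Sum>i = 1..b. c_val t (inner_seq k d i))"
      by (rule trace_info_mat_le[OF t k d'])
    \<comment> \<open>Each inner sequence of a competitor is itself a candidate in the maximization
      of c, so the bound holds block by block.\<close>
    also have "\<dots> \<le> (\<Sum>i = 1..b. c_val t lstar)"
      using inner_seq_seqs[OF t k d'] max by (intro sum_mono) blast
    finally have le: "mat_trace (?C d) \<le> mat_trace (?C dstar)" by (simp add: tr)
    show "\<Phi> (?C dstar) \<le> \<Phi> (?C d)"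
    proof (rule universal_optimality_criterion[OF _ \<Phi>])
      show "nnd_sym t (?C d)" "nnd_sym t (?C dstar)"
        using info_mat_nnd_sym[OF t k] d d' by auto
      show "(\<Sum>j\<in>{0..<t}. ?C d $$ (i, j)) = 0" "(\<Sum>j\<in>{0..<t}. ?C dstar $$ (i, j)) = 0"
        if "i < t" for i using info_mat_row_sum[OF t k _ that] d d' by auto
      show "0 < mat_trace (?C dstar)" using pos \<open>0 < b\<close> by (simp add: tr)
    qed (use inv le \<open>3 \<le> k\<close> \<open>k \<le> t\<close> in auto)
  qed
  thus ?thesis using tr f by simp
qed

end
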